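(* A graph on $5$ vertices is an SPN graph if and only if it does not contain the fan $F_5$ as a subgraph.
   Context: All graphs are finite and simple. A real symmetric matrix $A$ is copositive if $x^TAx\ge 0$ for every entrywise nonnegative vector $x$. A real symmetric matrix is SPN if it is the sum of a real positive semidefinite matrix and a symmetric entrywise nonnegative matrix. The graph $G(A)$ of a real symmetric $n\times n$ matrix $A$ has vertices $\{1,\dots,n\}$, and $ij$ ($i\ne j$) is an edge if and only if $a_{ij}\neq 0$. A graph $G$ is an SPN graph if every copositive matrix whose graph is $G$ is SPN (this does not depend on the labelling of the vertices). $F_5$ is the graph on $5$ vertices consisting of a path on $4$ vertices (length $3$) and an additional vertex adjacent to all four vertices of the path. Subgraphs are not necessarily induced. *)

theory Defs
  imports "Graph_Theory.Graph_Theory" "Jordan_Normal_Form.Matrix"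
begin

definition copositive :: "real mat \<Rightarrow> bool" where
  "copositive A \<longleftrightarrow> transpose_mat A = A \<and>
    (\<forall>x \<in> carrier_vec (dim_row A).
      (\<forall>i < dim_row A. 0 \<le> x $ i) \<longrightarrow> 0 \<le> x \<bullet> (A *\<^sub>v x))"

definition pos_semidefinite :: "real mat \<Rightarrow> bool" where
  "pos_semidefinite A \<longleftrightarrow> transpose_mat A = A \<and>
    (\<forall>x \<in> carrier_vec (dim_row A). 0 \<le> x \<bullet> (A *\<^sub>v x))"

definition sym_nonneg :: "real mat \<Rightarrow> bool" where
  "sym_nonneg A \<longleftrightarrow> transpose_mat A = A \<and>
    (\<forall>i < dim_row A. \<forall>j < dim_col A. 0 \<le> A $$ (i, j))"

text \<open>The carrier conditions are needed because addition of matrices of different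
  dimensions is underspecified.\<close>

definition SPN :: "real mat \<Rightarrow> bool" where
  "SPN A \<longleftrightarrow> (\<exists>P \<in> carrier_mat (dim_row A) (dim_col A). \<exists>N \<in> carrier_mat (dim_row A) (dim_col A).
    pos_semidefinite P \<and> sym_nonneg N \<and> A = P + N)"

text \<open>Undirected simple graphs are symmetric loopfree pair digraphs (\<^locale>\<open>pair_graph\<close>):
  every edge is stored in both orientations. Row and column indices start at 0, so the vertices
  of the graph of a matrix are \<open>0, \<dots>, n - 1\<close>.\<close>

definition mat_graph :: "real mat \<Rightarrow> nat pair_pre_digraph" where
  "mat_graph A = \<lparr> pverts = {..<dim_row A},
    parcs = {(i, j). i < dim_row A \<and> j < dim_row A \<and> i \<noteq> j \<and> A $$ (i, j) \<noteq> 0} \<rparr>"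

lemma pair_graph_mat_graph:
  assumes "transpose_mat A = A"
  shows "pair_graph (mat_graph A)"
proof -
  have dim: "dim_col A = dim_row A"
    using assms by (metis index_transpose_mat(2))
  have "A $$ (j, i) = A $$ (i, j)" if "i < dim_row A" "j < dim_row A" for i j
    using assms that dim by (metis index_transpose_mat(1))
  moreover have "finite {(i, j). i < dim_row A \<and> j < dim_row A \<and> i \<noteq> j \<and> A $$ (i, j) \<noteq> 0}"
    by (rule finite_subset[of _ "{..<dim_row A} \<times> {..<dim_row A}"]) auto
  ultimately show ?thesis
    by unfold_locales (auto simp: mat_graph_def symmetric_def sym_def)
qed

text \<open>The vertices of \<open>G\<close> may have any type; a matrix has graph \<open>G\<close> if its graph is \<open>G\<close> for some
  labelling of the vertices of \<open>G\<close> by row indices. The isomorphism forces the matrix to have as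
  many rows as \<open>G\<close> has vertices.\<close>

definition SPN_graph :: "'a pair_pre_digraph \<Rightarrow> bool" where
  "SPN_graph G \<longleftrightarrow> (\<forall>A. copositive A \<and>
    digraph_iso (with_proj (mat_graph A)) (with_proj G) \<longrightarrow> SPN A)"

definition contains_subgraph :: "'a pair_pre_digraph \<Rightarrow> 'b pair_pre_digraph \<Rightarrow> bool" where
  "contains_subgraph G K \<longleftrightarrow> (\<exists>H :: 'a pair_pre_digraph.
    subgraph (with_proj H) (with_proj G) \<and> digraph_iso (with_proj H) (with_proj K))"

text \<open>The path is 0, 1, 2, 3; vertex 4 is adjacent to all of its vertices.\<close>

definition F5 :: "nat pair_pre_digraph" where
  "F5 = (let E = {(0, 1), (1, 2), (2, 3), (4, 0), (4, 1), (4, 2), (4, 3)}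
    in \<lparr> pverts = {..<5}, parcs = E \<union> E\<inverse> \<rparr>)"

lemma pair_graph_F5: "pair_graph F5"
  by unfold_locales (auto simp: F5_def Let_def symmetric_def sym_def)

end

theory Submission
  imports Defs "HOL-Analysis.Function_Topology"
begin

text \<open>Lower entries of a strictly copositive form until a nonnegative zero \<open>u\<close> appears. The form is
  semidefinite on the support of \<open>u\<close>, and a copositive form with a semidefinite minor of
  codimension one is SPN, so only zeros of small support matter. In at most four variables,
  lowering positive entries one at a time never meets a small support. In five variables, a
  graph without a fan lies in one of four maximal graphs; in each of them the rows of vertices of
  degree two (or one) have constant sign, which reduces to four variables, or tell which
  coordinates of \<open>u\<close> cannot vanish.

  Conversely, the fan carries a copositive form with entries in \<open>{-1, 0, 1}\<close> that stays
  copositive but not SPN when its zero entries are raised to at most \<open>1 / 2\<close>.\<close>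

section \<open>Quadratic forms on finite index sets\<close>

text \<open>The obstacle is the size of the support of \<open>u\<close>: all but one index are
  needed, while lowering a single pair of entries only guarantees the two indices of that pair. The
  missing ones come from the first-order conditions at a zero: \<open>mv S A u\<close> is
  nonnegative and vanishes on the support, so a positive diagonal term in a support row must be
  balanced by a negative entry at another support index. Strictness supplies the positive diagonal.
  The general case follows by adding a small multiple of the identity, which leaves the graph
  unchanged, and passing to the limit. The fan is the complement of a path on four vertices plus an
  isolated vertex. Without it the complement contains a claw, a two-edge path with a disjoint edge,
  a triangle or a 4-cycle; the four maximal graphs are the complements of these. Conversely, a
  matrix for a graph with more edges than the fan must be nonzero on the extra edges, so one fixed
  matrix is not enough. A semidefinite part of the fan form would need the entry 1 between the ends
  of the path; the bound \<open>1 / 2\<close> rules this out.\<close>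

definition mv :: "'i set \<Rightarrow> ('i \<Rightarrow> 'i \<Rightarrow> real) \<Rightarrow> ('i \<Rightarrow> real) \<Rightarrow> 'i \<Rightarrow> real" where
  "mv S A x i = (\<Sum>j\<in>S. A i j * x j)"

definition qf :: "'i set \<Rightarrow> ('i \<Rightarrow> 'i \<Rightarrow> real) \<Rightarrow> ('i \<Rightarrow> real) \<Rightarrow> real" where
  "qf S A x = (\<Sum>i\<in>S. x i * mv S A x i)"

definition sym_on :: "'i set \<Rightarrow> ('i \<Rightarrow> 'i \<Rightarrow> real) \<Rightarrow> bool" where
  "sym_on S A \<longleftrightarrow> (\<forall>i\<in>S. \<forall>j\<in>S. A i j = A j i)"

definition cop_on :: "'i set \<Rightarrow> ('i \<Rightarrow> 'i \<Rightarrow> real) \<Rightarrow> bool" where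
  "cop_on S A \<longleftrightarrow> sym_on S A \<and> (\<forall>x. (\<forall>i\<in>S. 0 \<le> x i) \<longrightarrow> 0 \<le> qf S A x)"

definition scop_on :: "'i set \<Rightarrow> ('i \<Rightarrow> 'i \<Rightarrow> real) \<Rightarrow> bool" where
  "scop_on S A \<longleftrightarrow> sym_on S A \<and>
    (\<forall>x. (\<forall>i\<in>S. 0 \<le> x i) \<and> (\<exists>i\<in>S. x i \<noteq> 0) \<longrightarrow> 0 < qf S A x)"

definition psd_on :: "'i set \<Rightarrow> ('i \<Rightarrow> 'i \<Rightarrow> real) \<Rightarrow> bool" where
  "psd_on S A \<longleftrightarrow> sym_on S A \<and> (\<forall>x. 0 \<le> qf S A x)"

text \<open>The nonnegative summand stays implicit as \<open>A - P\<close>, so that raising entries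
  of \<open>A\<close> visibly preserves the property.\<close>

definition spn_on :: "'i set \<Rightarrow> ('i \<Rightarrow> 'i \<Rightarrow> real) \<Rightarrow> bool" where
  "spn_on S A \<longleftrightarrow> (\<exists>P. psd_on S P \<and> (\<forall>i\<in>S. \<forall>j\<in>S. P i j \<le> A i j))"

text \<open>For \<open>i = j\<close> the single entry is 1, not 2, so the same family lowers
  off-diagonal pairs and diagonal entries.\<close>

definition unit_pair :: "'i \<Rightarrow> 'i \<Rightarrow> 'i \<Rightarrow> 'i \<Rightarrow> real" where
  "unit_pair i j k l = (if k = i \<and> l = j \<or> k = j \<and> l = i then 1 else 0)"

definition add_diag :: "real \<Rightarrow> ('i \<Rightarrow> 'i \<Rightarrow> real) \<Rightarrow> 'i \<Rightarrow> 'i \<Rightarrow> real" where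
  "add_diag e A i j = A i j + (if i = j then e else 0)"

lemma qf_alt: "qf S A x = (\<Sum>i\<in>S. \<Sum>j\<in>S. A i j * x i * x j)"
  unfolding qf_def mv_def sum_distrib_left by (intro sum.cong refl) simp

lemma qf_cong:
  assumes "\<And>i j. i \<in> S \<Longrightarrow> j \<in> S \<Longrightarrow> A i j = B i j" "\<And>j. j \<in> S \<Longrightarrow> x j = y j"
  shows "qf S A x = qf S B y"
  unfolding qf_alt using assms by (intro sum.cong) auto

lemma sum_mv_swap:
  assumes "sym_on S A"
  shows "(\<Sum>i\<in>S. x i * mv S A y i) = (\<Sum>i\<in>S. y i * mv S A x i)"
proof -
  have "(\<Sum>i\<in>S. x i * mv S A y i) = (\<Sum>i\<in>S. \<Sum>j\<in>S. x i * A i j * y j)"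
    unfolding mv_def sum_distrib_left by (intro sum.cong refl) simp
  also have "\<dots> = (\<Sum>j\<in>S. \<Sum>i\<in>S. x i * A i j * y j)"
    by (rule sum.swap)
  also have "\<dots> = (\<Sum>j\<in>S. \<Sum>i\<in>S. y j * (A j i * x i))"
    using assms unfolding sym_on_def by (intro sum.cong refl) simp
  finally show ?thesis
    unfolding mv_def sum_distrib_left .
qed

lemma mv_add: "mv S A (\<lambda>i. x i + t * y i) k = mv S A x k + t * mv S A y k"
  unfolding mv_def by (simp add: sum.distrib sum_distrib_left algebra_simps)

lemma qf_add:
  assumes "sym_on S A"
  shows "qf S A (\<lambda>i. x i + t * y i) = qf S A x + 2 * t * (\<Sum>i\<in>S. x i * mv S A y i) + t\<^sup>2 * qf S A y"
proof -
  have "qf S A (\<lambda>i. x i + t * y i) = (\<Sum>i\<in>S. x i * mv S A x i) + t * (\<Sum>i\<in>S. x i * mv S A y i)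
     + t * (\<Sum>i\<in>S. y i * mv S A x i) + t * t * (\<Sum>i\<in>S. y i * mv S A y i)"
    unfolding qf_def mv_add by (simp add: algebra_simps sum.distrib sum_distrib_left)
  then show ?thesis
    using sum_mv_swap[OF assms, of y x] by (simp add: qf_def power2_eq_square)
qed

lemma qf_scale: "qf S A (\<lambda>i. t * x i) = t\<^sup>2 * qf S A x"
  unfolding qf_alt sum_distrib_left by (intro sum.cong refl) (simp add: power2_eq_square)

lemma qf_add_matrix: "qf S (\<lambda>i j. A i j + t * B i j) x = qf S A x + t * qf S B x"
  unfolding qf_alt by (simp add: sum.distrib sum_distrib_left algebra_simps)

lemma qf_diff_matrix: "qf S (\<lambda>i j. A i j - t * B i j) x = qf S A x - t * qf S B x"
  using qf_add_matrix[of S A "-t" B x] by simp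

lemma mv_restrict:
  assumes "finite S" "T \<subseteq> S" "\<And>i. i \<in> S - T \<Longrightarrow> x i = 0"
  shows "mv S A x k = mv T A x k"
  unfolding mv_def using assms by (intro sum.mono_neutral_right) auto

lemma qf_restrict:
  assumes "finite S" "T \<subseteq> S" "\<And>i. i \<in> S - T \<Longrightarrow> x i = 0"
  shows "qf S A x = qf T A x"
proof -
  have "qf S A x = (\<Sum>i\<in>T. x i * mv S A x i)"
    unfolding qf_def using assms by (intro sum.mono_neutral_right) auto
  then show ?thesis
    unfolding qf_def using mv_restrict[of S T x A] assms by simp
qed

lemma qf_pair:
  assumes "finite S" "i \<in> S" "j \<in> S" "i \<noteq> j" "\<And>k. k \<in> S - {i, j} \<Longrightarrow> x k = 0"
  shows "qf S A x = A i i * (x i)\<^sup>2 + A j j * (x j)\<^sup>2 + (A i j + A j i) * x i * x j"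
  using qf_restrict[of S "{i, j}" x A] assms
  by (auto simp: qf_alt power2_eq_square algebra_simps)

lemma qf_single:
  assumes "finite S" "i \<in> S" "\<And>k. k \<in> S - {i} \<Longrightarrow> x k = 0"
  shows "qf S A x = A i i * (x i)\<^sup>2"
  using qf_restrict[of S "{i}" x A] assms by (auto simp: qf_alt power2_eq_square)

lemma qf_split:
  assumes "finite S" "v \<in> S" "sym_on S A"
  shows "qf S A x = A v v * (x v)\<^sup>2 + 2 * x v * mv (S - {v}) A x v + qf (S - {v}) A x"
proof -
  let ?T = "S - {v}"
  have mv: "mv S A x i = A i v * x v + mv ?T A x i" for i
    unfolding mv_def using assms by (simp add: sum.remove)
  have "qf S A x = x v * mv S A x v + (\<Sum>i\<in>?T. x i * mv S A x i)"
    unfolding qf_def using assms by (simp add: sum.remove)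
  also have "(\<Sum>i\<in>?T. x i * mv S A x i) = (\<Sum>i\<in>?T. x i * (A i v * x v)) + qf ?T A x"
    unfolding mv qf_def by (simp add: algebra_simps sum.distrib)
  also have "(\<Sum>i\<in>?T. x i * (A i v * x v)) = x v * mv ?T A x v"
    unfolding mv_def sum_distrib_left using assms
    by (intro sum.cong refl) (auto simp: sym_on_def)
  finally show ?thesis
    by (simp add: mv power2_eq_square algebra_simps)
qed

lemma qf_union:
  assumes "finite S" "finite T" "S \<inter> T = {}" "sym_on (S \<union> T) A"
  shows "qf (S \<union> T) A x = qf S A x + qf T A x + 2 * (\<Sum>i\<in>S. \<Sum>j\<in>T. A i j * x i * x j)"
proof -
  have "(\<Sum>i\<in>T. \<Sum>j\<in>S. A i j * x i * x j) = (\<Sum>i\<in>S. \<Sum>j\<in>T. A i j * x i * x j)"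
    by (subst sum.swap) (use assms in \<open>auto simp: sym_on_def intro!: sum.cong\<close>)
  then show ?thesis
    unfolding qf_alt using assms by (simp add: sum.union_disjoint sum.distrib)
qed

lemma qf_unit_pair:
  assumes "finite S" "i \<in> S" "j \<in> S" "i \<noteq> j"
  shows "qf S (unit_pair i j) x = 2 * x i * x j"
proof -
  have "qf S (unit_pair i j) x = qf S (unit_pair i j) (\<lambda>k. if k \<in> {i, j} then x k else 0)"
    unfolding qf_alt unit_pair_def by (intro sum.cong refl) auto
  then show ?thesis
    using qf_pair[OF assms, of "\<lambda>k. if k \<in> {i, j} then x k else 0" "unit_pair i j"] assms
    by (simp add: unit_pair_def)
qed

lemma qf_unit_diag:
  assumes "finite S" "i \<in> S"
  shows "qf S (unit_pair i i) x = (x i)\<^sup>2"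
proof -
  have "qf S (unit_pair i i) x = qf S (unit_pair i i) (\<lambda>k. if k = i then x k else 0)"
    unfolding qf_alt unit_pair_def by (intro sum.cong refl) auto
  then show ?thesis
    using qf_single[OF assms, of "\<lambda>k. if k = i then x k else 0" "unit_pair i i"]
    by (simp add: unit_pair_def)
qed

lemma qf_add_diag:
  assumes "finite S"
  shows "qf S (add_diag e A) x = qf S A x + e * (\<Sum>i\<in>S. (x i)\<^sup>2)"
proof -
  have "mv S (add_diag e A) x i = mv S A x i + e * x i" if "i \<in> S" for i
  proof -
    have "(\<Sum>j\<in>S. (if i = j then e else 0) * x j) = (\<Sum>j\<in>S. if i = j then e * x j else 0)"
      by (intro sum.cong) auto
    then show ?thesis
      unfolding mv_def add_diag_def using assms that by (simp add: algebra_simps sum.distrib)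
  qed
  then show ?thesis
    unfolding qf_def by (simp add: algebra_simps sum.distrib sum_distrib_left power2_eq_square)
qed

lemma sym_on_add_diag: "sym_on S A \<Longrightarrow> sym_on S (add_diag e A)"
  unfolding sym_on_def add_diag_def by auto

lemma sym_on_subset: "sym_on S A \<Longrightarrow> T \<subseteq> S \<Longrightarrow> sym_on T A"
  unfolding sym_on_def by blast

lemma sym_on_unit_pair: "sym_on S (unit_pair i j)"
  unfolding sym_on_def unit_pair_def by auto

lemma sym_on_diff: "sym_on S A \<Longrightarrow> sym_on S B \<Longrightarrow> sym_on S (\<lambda>i j. A i j - t * B i j)"
  unfolding sym_on_def by auto

lemma cop_on_subset:
  assumes "cop_on S A" "T \<subseteq> S" "finite S"
  shows "cop_on T A"
proof -
  have "0 \<le> qf T A x" if "\<forall>i\<in>T. 0 \<le> x i" for x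
  proof -
    have "qf S A (\<lambda>i. if i \<in> T then x i else 0) = qf T A (\<lambda>i. if i \<in> T then x i else 0)"
      using assms by (intro qf_restrict) auto
    also have "\<dots> = qf T A x" by (rule qf_cong) auto
    moreover have "0 \<le> qf S A (\<lambda>i. if i \<in> T then x i else 0)"
      using assms(1) that unfolding cop_on_def by auto
    ultimately show ?thesis by simp
  qed
  then show ?thesis using assms sym_on_subset unfolding cop_on_def by blast
qed

lemma scop_imp_cop: "scop_on S A \<Longrightarrow> cop_on S A"
  unfolding scop_on_def cop_on_def
proof (intro conjI allI impI)
  fix x :: "'a \<Rightarrow> real"
  assume *: "sym_on S A \<and> (\<forall>x. (\<forall>i\<in>S. 0 \<le> x i) \<and> (\<exists>i\<in>S. x i \<noteq> 0) \<longrightarrow> 0 < qf S A x)"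
    and x: "\<forall>i\<in>S. 0 \<le> x i"
  show "0 \<le> qf S A x"
  proof (cases "\<exists>i\<in>S. x i \<noteq> 0")
    case True then show ?thesis using * x by (auto intro: less_imp_le)
  next
    case False then show ?thesis unfolding qf_def by simp
  qed
qed auto

lemma cop_add_diag_scop:
  assumes "cop_on S A" "finite S" "e > 0"
  shows "scop_on S (add_diag e A)"
proof -
  have "0 < qf S (add_diag e A) x" if "\<forall>i\<in>S. 0 \<le> x i" "i \<in> S" "x i \<noteq> 0" for x i
  proof -
    have "0 < (\<Sum>i\<in>S. (x i)\<^sup>2)"
      by (rule sum_pos2[OF assms(2) that(2)]) (use that in auto)
    then show ?thesis
      using assms that unfolding qf_add_diag[OF assms(2)] cop_on_def
      by (smt (verit) mult_pos_pos)
  qed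
  then show ?thesis
    using assms sym_on_add_diag unfolding scop_on_def cop_on_def by blast
qed

lemma spn_on_mono:
  assumes "spn_on S A" "\<And>i j. i \<in> S \<Longrightarrow> j \<in> S \<Longrightarrow> A i j \<le> B i j"
  shows "spn_on S B"
  using assms unfolding spn_on_def by (meson order_trans)

lemma psd_imp_spn: "psd_on S A \<Longrightarrow> spn_on S A"
  unfolding spn_on_def by blast

lemma scop_diag_pos:
  assumes "scop_on S A" "finite S" "i \<in> S"
  shows "A i i > 0"
proof -
  let ?x = "\<lambda>k. if k = i then 1 else 0 :: real"
  have "0 < qf S A ?x" using assms unfolding scop_on_def by auto
  then show ?thesis using qf_single[OF assms(2,3), of ?x A] by simp
qed

section \<open>Two compactness arguments\<close>

lemma compact_box:
  fixes K :: "'i \<Rightarrow> 'b :: topological_space set"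
  assumes "\<And>i. compact (K i)"
  shows "compact {x. \<forall>i. x i \<in> K i}"
proof -
  have "compactin (product_topology (\<lambda>i. euclidean) UNIV) (PiE UNIV K)"
    using assms by (simp add: compactin_PiE)
  moreover have "PiE UNIV K = {x. \<forall>i. x i \<in> K i}" by auto
  ultimately show ?thesis
    by (simp add: euclidean_product_topology)
qed

lemma continuous_on_coord: "continuous_on T (\<lambda>x. x i :: 'b :: topological_space)"
  by (rule continuous_on_subset[OF continuous_on_product_coordinates]) simp

lemma continuous_on_qf: "continuous_on T (qf S A)"
  unfolding qf_alt[abs_def] by (intro continuous_intros continuous_on_coord)

lemma continuous_on_entry: "continuous_on T (\<lambda>P. P i j :: real)"
  by (rule continuous_on_product_then_coordinatewise) (rule continuous_on_coord)

lemma continuous_on_qf_matrix: "continuous_on T (\<lambda>P. qf S P x)"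
  unfolding qf_alt[abs_def] by (intro continuous_intros continuous_on_entry)

text \<open>A box cut by a closed hyperplane. Coordinates outside \<open>S\<close> are pinned to 0,
  so that Tychonoff's theorem applies over the whole, possibly infinite, index type.\<close>

definition simplex_on :: "'i set \<Rightarrow> ('i \<Rightarrow> real) set" where
  "simplex_on S = {x. (\<forall>i\<in>S. 0 \<le> x i \<and> x i \<le> 1) \<and> (\<forall>i. i \<notin> S \<longrightarrow> x i = 0) \<and> (\<Sum>i\<in>S. x i) = 1}"

lemma compact_simplex_on: "compact (simplex_on S)"
proof -
  have "closed {x :: 'a \<Rightarrow> real. (\<Sum>i\<in>S. x i) = 1}"
    by (intro closed_Collect_eq continuous_intros continuous_on_coord)
  then have "compact ({x :: 'a \<Rightarrow> real. \<forall>i. x i \<in> (if i \<in> S then {0..1} else {0})} \<inter> {x. (\<Sum>i\<in>S. x i) = 1})"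
    by (intro compact_Int_closed compact_box) auto
  also have "{x :: 'a \<Rightarrow> real. \<forall>i. x i \<in> (if i \<in> S then {0..1} else {0})} \<inter> {x. (\<Sum>i\<in>S. x i) = 1} = simplex_on S"
    unfolding simplex_on_def by (auto split: if_splits)
  finally show ?thesis .
qed

lemma simplex_on_normalize:
  assumes "finite S" "\<forall>i\<in>S. 0 \<le> x i" "\<exists>i\<in>S. x i \<noteq> 0"
  obtains c y where "c > 0" "y \<in> simplex_on S" "\<And>i. i \<in> S \<Longrightarrow> x i = c * y i"
proof -
  define c where "c = (\<Sum>i\<in>S. x i)"
  have c: "c > 0" unfolding c_def using assms
    by (metis less_eq_real_def sum_nonneg sum_nonneg_eq_0_iff)
  have le: "x i \<le> c" if "i \<in> S" for i
    unfolding c_def using assms that by (intro member_le_sum) auto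
  let ?y = "\<lambda>i. if i \<in> S then x i / c else 0"
  have "(\<Sum>i\<in>S. ?y i) = 1"
    using c by (simp add: c_def flip: sum_divide_distrib)
  then have "?y \<in> simplex_on S"
    using assms c le unfolding simplex_on_def by auto
  then show ?thesis using c that[of c ?y] by auto
qed

text \<open>The critical \<open>d\<close> is the minimum of \<open>qf S A x / qf S D x\<close>, and
  \<open>u\<close> is a minimiser. The minimum is taken over the compact part \<open>K\<close> of
  the simplex where \<open>A - m * D\<close> is not positive: there \<open>qf S D\<close> is
  positive because \<open>qf S A\<close> is, so the quotient is continuous, and outside
  \<open>K\<close> every \<open>d\<close> up to \<open>m\<close> is harmless. The conclusion
  \<open>qf S D u > 0\<close> tells which coordinates of \<open>u\<close> are nonzero.\<close>

lemma reduce_to_zero: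
  assumes fin: "finite S" and A: "scop_on S A" and D: "sym_on S D"
    and nn: "\<And>i j. i \<in> S \<Longrightarrow> j \<in> S \<Longrightarrow> 0 \<le> D i j" and m: "0 \<le> m"
    and not: "\<not> scop_on S (\<lambda>i j. A i j - m * D i j)"
  obtains d u where "0 \<le> d" "d \<le> m" "cop_on S (\<lambda>i j. A i j - d * D i j)"
    "\<forall>i\<in>S. 0 \<le> u i" "qf S (\<lambda>i j. A i j - d * D i j) u = 0" "qf S D u > 0"
proof -
  have sym: "sym_on S (\<lambda>i j. A i j - t * D i j)" for t
    using A D sym_on_diff unfolding scop_on_def by blast
  have pos: "0 < qf S A x" if "x \<in> simplex_on S" for x
  proof -
    have "sum x S \<noteq> 0" using that unfolding simplex_on_def by simp
    then have "\<exists>i\<in>S. x i \<noteq> 0" by (rule sum.not_neutral_contains_not_neutral) blast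
    moreover have "\<forall>i\<in>S. 0 \<le> x i" using that unfolding simplex_on_def by auto
    ultimately show ?thesis using A unfolding scop_on_def by blast
  qed
  define K where "K = simplex_on S \<inter> {x. qf S A x \<le> m * qf S D x}"
  have "compact K" unfolding K_def
    by (intro compact_Int_closed compact_simplex_on closed_Collect_le continuous_intros
        continuous_on_qf)
  have Dpos: "qf S D x > 0" if "x \<in> K" for x
  proof (rule ccontr)
    assume "\<not> qf S D x > 0"
    then have "m * qf S D x \<le> 0" using m by (intro mult_nonneg_nonpos) auto
    then show False using pos[of x] that unfolding K_def by auto
  qed
  have "K \<noteq> {}"
  proof -
    obtain x where x: "\<forall>i\<in>S. 0 \<le> x i" "\<exists>i\<in>S. x i \<noteq> 0" "qf S (\<lambda>i j. A i j - m * D i j) x \<le> 0"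
      using not sym unfolding scop_on_def by force
    obtain c y where y: "c > 0" "y \<in> simplex_on S" "\<And>i. i \<in> S \<Longrightarrow> x i = c * y i"
      using simplex_on_normalize[OF fin x(1,2)] by blast
    have "qf S (\<lambda>i j. A i j - m * D i j) x = c\<^sup>2 * qf S (\<lambda>i j. A i j - m * D i j) y"
      unfolding qf_scale[symmetric] by (rule qf_cong) (use y in auto)
    then have "qf S (\<lambda>i j. A i j - m * D i j) y \<le> 0"
      using x(3) y(1) by (simp add: mult_le_0_iff)
    then show ?thesis using y unfolding K_def qf_diff_matrix by auto
  qed
  have "continuous_on K (\<lambda>x. qf S A x / qf S D x)"
    using Dpos by (intro continuous_intros continuous_on_qf) (auto simp: less_imp_neq[symmetric])
  then obtain u where u: "u \<in> K" "\<And>x. x \<in> K \<Longrightarrow> qf S A u / qf S D u \<le> qf S A x / qf S D x"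
    using continuous_attains_inf[OF \<open>compact K\<close> \<open>K \<noteq> {}\<close>] by blast
  define d where "d = qf S A u / qf S D u"
  have uS: "u \<in> simplex_on S" using u unfolding K_def by auto
  have d0: "0 \<le> d" unfolding d_def using Dpos[OF u(1)] pos[OF uS] by simp
  have dm: "d \<le> m" unfolding d_def using Dpos[OF u(1)] u(1) unfolding K_def by (simp add: divide_le_eq)
  have ge: "0 \<le> qf S A x - d * qf S D x" if "x \<in> simplex_on S" for x
  proof (cases "x \<in> K")
    case True
    then have "d \<le> qf S A x / qf S D x" using u unfolding d_def by blast
    then show ?thesis using Dpos[OF True] by (simp add: le_divide_eq)
  next
    case False
    have "0 \<le> qf S D x"
      unfolding qf_alt using that nn by (intro sum_nonneg) (auto simp: simplex_on_def split: if_splits)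
    then have "d * qf S D x \<le> m * qf S D x" using dm by (intro mult_right_mono)
    then show ?thesis using False that unfolding K_def by auto
  qed
  have "0 \<le> qf S (\<lambda>i j. A i j - d * D i j) x" if x: "\<forall>i\<in>S. 0 \<le> x i" for x
  proof (cases "\<exists>i\<in>S. x i \<noteq> 0")
    case True
    obtain c y where y: "c > 0" "y \<in> simplex_on S" "\<And>i. i \<in> S \<Longrightarrow> x i = c * y i"
      using simplex_on_normalize[OF fin x True] by blast
    have "qf S (\<lambda>i j. A i j - d * D i j) x = c\<^sup>2 * qf S (\<lambda>i j. A i j - d * D i j) y"
      unfolding qf_scale[symmetric] by (rule qf_cong) (use y in auto)
    then show ?thesis using ge[OF y(2)] by (simp add: qf_diff_matrix)
  next
    case False then show ?thesis unfolding qf_def by simp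
  qed
  then have "cop_on S (\<lambda>i j. A i j - d * D i j)" using sym unfolding cop_on_def by blast
  moreover have "qf S (\<lambda>i j. A i j - d * D i j) u = 0"
    using Dpos[OF u(1)] unfolding qf_diff_matrix d_def by simp
  moreover have "\<forall>i\<in>S. 0 \<le> u i" using uS unfolding simplex_on_def by auto
  ultimately show ?thesis using that d0 dm Dpos[OF u(1)] by blast
qed

lemma psd_entry_bound:
  assumes "psd_on S P" "finite S" "i \<in> S" "j \<in> S"
  shows "\<bar>P i j\<bar> \<le> (P i i + P j j) / 2" and "0 \<le> P i i"
proof -
  let ?e = "\<lambda>k. if k = i then 1 else 0 :: real"
  have "0 \<le> qf S P ?e" using assms unfolding psd_on_def by blast
  then show ii: "0 \<le> P i i" using qf_single[OF assms(2,3), of ?e P] by simp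
  show "\<bar>P i j\<bar> \<le> (P i i + P j j) / 2"
  proof (cases "i = j")
    case True then show ?thesis using ii by simp
  next
    case False
    let ?x = "\<lambda>s k. if k = i then 1 else if k = j then s else 0 :: real"
    have "0 \<le> P i i + P j j * s\<^sup>2 + 2 * P i j * s" for s
    proof -
      have "0 \<le> qf S P (?x s)" using assms unfolding psd_on_def by blast
      moreover have "P j i = P i j" using assms unfolding psd_on_def sym_on_def by auto
      ultimately show ?thesis using qf_pair[OF assms(2-4) False, of "?x s" P] False by auto
    qed
    from this[of 1] this[of "-1"] show ?thesis by auto
  qed
qed

text \<open>For \<open>e \<le> 1\<close> the semidefinite parts have bounded diagonals, and a
  semidefinite form is bounded by its diagonal, so they lie in a compact set \<open>K\<close>.
  Minimising the total excess \<open>g\<close> of \<open>P\<close> over \<open>A\<close> on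
  \<open>K\<close> takes the place of a convergent subsequence: the minimum is at most a multiple of
  every small \<open>e\<close>, hence 0.\<close>

lemma spn_on_closed:
  assumes fin: "finite S" and spn: "\<And>e. e > 0 \<Longrightarrow> spn_on S (add_diag e A)"
  shows "spn_on S A"
proof -
  define M where "M = (\<Sum>i\<in>S. \<bar>A i i\<bar> + 1)"
  define B where "B = {P :: 'a \<Rightarrow> 'a \<Rightarrow> real.
     \<forall>i. P i \<in> {x. \<forall>j. x j \<in> (if i \<in> S \<and> j \<in> S then {-M..M} else {0})}}"
  define K where "K = B \<inter> {P. psd_on S P}"
  have psd_closed: "closed {P :: 'a \<Rightarrow> 'a \<Rightarrow> real. psd_on S P}"
  proof -
    have "{P :: 'a \<Rightarrow> 'a \<Rightarrow> real. psd_on S P} =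
       (\<Inter>i\<in>S. \<Inter>j\<in>S. {P. P i j = P j i}) \<inter> (\<Inter>x. {P. 0 \<le> qf S P x})"
      unfolding psd_on_def sym_on_def by auto
    then show ?thesis
      by (auto intro!: closed_INT closed_Int closed_Collect_eq closed_Collect_le continuous_intros
          continuous_on_entry continuous_on_qf_matrix)
  qed
  have "compact K" unfolding K_def B_def
    by (intro compact_Int_closed psd_closed compact_box) auto
  have in_K: "\<exists>P\<in>K. \<forall>i\<in>S. \<forall>j\<in>S. P i j \<le> add_diag e A i j" if e: "0 < e" "e \<le> 1" for e
  proof -
    obtain P where P: "psd_on S P" "\<And>i j. i \<in> S \<Longrightarrow> j \<in> S \<Longrightarrow> P i j \<le> add_diag e A i j"
      using spn[OF e(1)] unfolding spn_on_def by blast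
    have diag: "P i i \<le> M" if "i \<in> S" for i
    proof -
      have "\<bar>A i i\<bar> + 1 \<le> M" unfolding M_def by (rule member_le_sum) (use fin that in auto)
      then show ?thesis using P(2)[OF that that] e unfolding add_diag_def by simp
    qed
    have half_le: "(a + b) / 2 \<le> M" if "a \<le> M" "b \<le> M" for a b :: real
      using that by simp
    have ab: "\<bar>P i j\<bar> \<le> M" if "i \<in> S" "j \<in> S" for i j
      using psd_entry_bound(1)[OF P(1) fin that] half_le[OF diag[OF that(1)] diag[OF that(2)]]
      by (rule order_trans)
    then have bd: "- M \<le> P i j \<and> P i j \<le> M" if "i \<in> S" "j \<in> S" for i j
      using abs_le_D1[OF ab[OF that]] abs_le_D2[OF ab[OF that]] by simp
    let ?P = "\<lambda>i j. if i \<in> S \<and> j \<in> S then P i j else 0"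
    have "qf S ?P x = qf S P x" for x by (rule qf_cong) auto
    then have "psd_on S ?P" using P(1) unfolding psd_on_def sym_on_def by auto
    then have "?P \<in> K" using bd unfolding K_def B_def by auto
    then show ?thesis using P(2) by (intro bexI[of _ ?P]) auto
  qed
  define g where "g P = (\<Sum>i\<in>S. \<Sum>j\<in>S. max 0 (P i j - A i j))" for P :: "'a \<Rightarrow> 'a \<Rightarrow> real"
  have "continuous_on K g"
    unfolding g_def[abs_def] by (intro continuous_intros continuous_on_entry)
  moreover have "K \<noteq> {}" using in_K[of 1] by auto
  ultimately obtain Q where Q: "Q \<in> K" "\<And>P. P \<in> K \<Longrightarrow> g Q \<le> g P"
    using continuous_attains_inf[OF \<open>compact K\<close>] by blast
  have small: "g Q \<le> e * (real (card S) * real (card S))" if e: "0 < e" "e \<le> 1" for e :: real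
  proof -
    obtain P where P: "P \<in> K" "\<And>i j. i \<in> S \<Longrightarrow> j \<in> S \<Longrightarrow> P i j \<le> add_diag e A i j"
      using in_K[OF e] by blast
    have "g P \<le> (\<Sum>i\<in>S. \<Sum>j\<in>S. e)"
      unfolding g_def using P(2) e by (intro sum_mono) (fastforce simp: add_diag_def split: if_splits)
    then show ?thesis using Q(2)[OF P(1)] by (simp add: mult_ac)
  qed
  have "g Q \<le> 0"
  proof (rule field_le_epsilon)
    fix e :: real assume e: "0 < e"
    \<comment> \<open>The added 1 keeps \<open>c\<close> positive for empty \<open>S\<close>; the
      cut-off at 1 below is needed because \<open>small\<close> covers only
      \<open>e \<le> 1\<close>.\<close>
    define c where "c = real (card S) * real (card S) + 1"
    have c: "c > 0" unfolding c_def by (simp add: add_nonneg_pos)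
    have "g Q \<le> min 1 (e / c) * (real (card S) * real (card S))" using small[of "min 1 (e / c)"] e c by simp
    also have "\<dots> \<le> e / c * c" using e c unfolding c_def by (intro mult_mono) auto
    finally show "g Q \<le> 0 + e" using c by simp
  qed
  moreover have entry: "max 0 (Q i j - A i j) \<le> g Q" if "i \<in> S" "j \<in> S" for i j
  proof -
    have "max 0 (Q i j - A i j) \<le> (\<Sum>j\<in>S. max 0 (Q i j - A i j))"
      using fin that by (intro member_le_sum) auto
    also have "\<dots> \<le> g Q"
      unfolding g_def using fin that
      by (intro member_le_sum[of i S "\<lambda>i. \<Sum>j\<in>S. max 0 (Q i j - A i j)"]) (auto intro: sum_nonneg)
    finally show ?thesis .
  qed
  ultimately have "Q i j \<le> A i j" if "i \<in> S" "j \<in> S" for i j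
    using entry[OF that] by linarith
  then show ?thesis using Q(1) unfolding spn_on_def K_def by blast
qed

lemma cop_onD: "cop_on S A \<Longrightarrow> \<forall>i\<in>S. 0 \<le> x i \<Longrightarrow> 0 \<le> qf S A x"
  unfolding cop_on_def by blast

lemma unit_pair_nonneg: "0 \<le> unit_pair i j k l"
  unfolding unit_pair_def by simp

lemma psd_onD: "psd_on S A \<Longrightarrow> 0 \<le> qf S A x"
  unfolding psd_on_def by blast

section \<open>Zeros of copositive forms and bordered semidefinite forms\<close>

text \<open>A zero minimises the form on the nonnegative orthant, and \<open>2 * mv S A u k\<close>
  is its derivative in the feasible direction \<open>k\<close>.\<close>

lemma zero_mv_nonneg:
  assumes A: "cop_on S A" and fin: "finite S" and u: "\<forall>i\<in>S. 0 \<le> u i" "qf S A u = 0" and k: "k \<in> S"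
  shows "0 \<le> mv S A u k"
proof (rule ccontr)
  assume neg: "\<not> 0 \<le> mv S A u k"
  let ?e = "\<lambda>i. if i = k then 1 else 0 :: real"
  define m where "m = mv S A u k"
  define a where "a = A k k"
  have sym: "sym_on S A" using A unfolding cop_on_def by blast
  have "(\<Sum>i\<in>S. u i * mv S A ?e i) = (\<Sum>i\<in>S. ?e i * mv S A u i)"
    by (rule sum_mv_swap[OF sym])
  also have "\<dots> = (\<Sum>i\<in>S. if i = k then mv S A u i else 0)"
    by (intro sum.cong) auto
  also have "\<dots> = m" using fin k by (simp add: m_def)
  finally have lin: "(\<Sum>i\<in>S. u i * mv S A ?e i) = m" .
  have ek: "qf S A ?e = a" using qf_single[OF fin k, of ?e A] by (simp add: a_def)
  have "0 \<le> qf S A ?e" by (intro cop_onD[OF A]) auto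
  then have a: "0 \<le> a" using ek by simp
  \<comment> \<open>Along direction \<open>k\<close> the form equals
    \<open>t * (2 * m + t * a)\<close>. This \<open>t\<close> gives \<open>t * a \<le> - m\<close>,
    so the bracket is at most \<open>m < 0\<close>; the 1 covers \<open>a = 0\<close>.\<close>
  define t where "t = - m / (a + 1)"
  have t: "t > 0" using neg a unfolding t_def m_def by (simp add: divide_neg_pos)
  have "0 \<le> qf S A (\<lambda>i. u i + t * ?e i)"
    using u t by (intro cop_onD[OF A]) auto
  also have "\<dots> = t * (2 * m + t * a)"
    unfolding qf_add[OF sym] lin ek u(2) by (simp add: power2_eq_square algebra_simps)
  finally have "0 \<le> 2 * m + t * a" using t by (simp add: zero_le_mult_iff)
  moreover have "t * a \<le> t * (a + 1)" using t by simp
  moreover have "t * (a + 1) = - m" unfolding t_def using a by simp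
  ultimately show False using neg unfolding m_def by linarith
qed

text \<open>Complementary slackness: the value 0 is a sum of the nonnegative terms
  \<open>u i * mv S A u i\<close>.\<close>

lemma zero_mv_support:
  assumes A: "cop_on S A" and fin: "finite S" and u: "\<forall>i\<in>S. 0 \<le> u i" "qf S A u = 0"
    and k: "k \<in> S"
  shows "u k * mv S A u k = 0"
proof -
  have "\<forall>i\<in>S. u i * mv S A u i = 0"
    using u(2) zero_mv_nonneg[OF A fin u] u(1) fin unfolding qf_def
    by (subst (asm) sum_nonneg_eq_0_iff) auto
  then show ?thesis using k by blast
qed

text \<open>On its support \<open>u\<close> is strictly positive and lies in the kernel. Adding a
  large multiple of \<open>u\<close> therefore makes any \<open>x\<close> nonnegative without
  changing the value of the form.\<close>

lemma zero_support_psd: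
  assumes A: "cop_on S A" and fin: "finite S" and u: "\<forall>i\<in>S. 0 \<le> u i" "qf S A u = 0"
  shows "psd_on {i \<in> S. u i \<noteq> 0} A"
proof -
  define J where "J = {i \<in> S. u i \<noteq> 0}"
  have J: "J \<subseteq> S" "finite J" using fin unfolding J_def by auto
  have up: "u i > 0" if "i \<in> J" for i using that u(1) unfolding J_def by force
  have sym: "sym_on J A" using A J sym_on_subset unfolding cop_on_def by blast
  have copJ: "cop_on J A" by (rule cop_on_subset[OF A J(1) fin])
  have mv0: "mv J A u i = 0" if "i \<in> J" for i
  proof -
    have "mv S A u i = mv J A u i" by (rule mv_restrict[OF fin J(1)]) (auto simp: J_def)
    then show ?thesis using zero_mv_support[OF A fin u, of i] that unfolding J_def by auto
  qed
  have "0 \<le> qf J A x" for x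
  proof -
    define t where "t = (\<Sum>i\<in>J. \<bar>x i\<bar> / u i)"
    have "0 \<le> x i + t * u i" if i: "i \<in> J" for i
    proof -
      have "\<bar>x i\<bar> / u i \<le> t"
        unfolding t_def using J up i by (intro member_le_sum) (auto intro: divide_nonneg_pos)
      then have "\<bar>x i\<bar> \<le> t * u i" using up[OF i] by (simp add: pos_divide_le_eq)
      then show ?thesis by linarith
    qed
    then have "0 \<le> qf J A (\<lambda>i. x i + t * u i)" by (intro cop_onD[OF copJ] ballI)
    moreover have "qf J A u = 0" unfolding qf_def using mv0 by simp
    moreover have "(\<Sum>i\<in>J. x i * mv J A u i) = 0" using mv0 by simp
    ultimately show ?thesis unfolding qf_add[OF sym] by simp
  qed
  then show ?thesis using sym unfolding psd_on_def J_def by blast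
qed

text \<open>Subtracting \<open>x v\<close> times the kernel vector \<open>u\<close> clears
  coordinate \<open>v\<close> and keeps the value, so only the minor is ever evaluated.\<close>

lemma psd_on_extend:
  assumes fin: "finite S" and v: "v \<in> S" and sym: "sym_on S P" and psd: "psd_on (S - {v}) P"
    and u: "\<And>k. k \<in> S \<Longrightarrow> mv S P u k = 0" "u v = 1"
  shows "psd_on S P"
proof -
  have "0 \<le> qf S P x" for x
  proof -
    have "qf S P (\<lambda>i. x i + (- x v) * u i) = qf S P x"
      unfolding qf_add[OF sym] using u(1) by (simp add: qf_def)
    moreover have "qf S P (\<lambda>i. x i + (- x v) * u i) = qf (S - {v}) P (\<lambda>i. x i + (- x v) * u i)"
      using u(2) by (intro qf_restrict[OF fin]) auto
    ultimately show ?thesis using psd_onD[OF psd, of "\<lambda>i. x i + (- x v) * u i"] by linarith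
  qed
  then show ?thesis using sym unfolding psd_on_def by blast
qed

text \<open>Decreasing the diagonal entry at \<open>v\<close> until copositivity is about to fail produces a zero
  \<open>u\<close> with \<open>u v > 0\<close>; subtracting the nonnegative vector \<open>A u\<close> from row and column \<open>v\<close> puts \<open>u\<close>
  into the kernel.\<close>

lemma psd_minor_imp_spn_strict:
  assumes A: "scop_on S A" and fin: "finite S" and v: "v \<in> S" and psd: "psd_on (S - {v}) A"
  shows "spn_on S A"
proof -
  let ?D = "unit_pair v v" and ?T = "S - {v}"
  have symA: "sym_on S A" using A unfolding scop_on_def by blast
  have not_scop: "\<not> scop_on S (\<lambda>i j. A i j - A v v * ?D i j)"
    using scop_diag_pos[OF _ fin v, of "\<lambda>i j. A i j - A v v * ?D i j"] by (auto simp: unit_pair_def)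
  have Avv: "0 \<le> A v v" using scop_diag_pos[OF A fin v] by simp
  obtain d u where d: "0 \<le> d" "d \<le> A v v" and cop: "cop_on S (\<lambda>i j. A i j - d * ?D i j)"
    and u: "\<forall>i\<in>S. 0 \<le> u i" "qf S (\<lambda>i j. A i j - d * ?D i j) u = 0" "qf S ?D u > 0"
    by (rule reduce_to_zero[OF fin A sym_on_unit_pair unit_pair_nonneg Avv not_scop])
  define B where "B = (\<lambda>i j. A i j - d * ?D i j)"
  have uv: "u v > 0" using u v by (simp add: qf_unit_diag[OF fin v] less_le)
  define w where "w = (\<lambda>i. (1 / u v) * u i)"
  have w: "\<forall>i\<in>S. 0 \<le> w i" "qf S B w = 0" "w v = 1"
    using u uv unfolding w_def B_def qf_scale by auto
  have copB: "cop_on S B" using cop unfolding B_def .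
  define m where "m = mv S B w"
  have m0: "0 \<le> m k" "w k * m k = 0" if "k \<in> S" for k
    using zero_mv_nonneg[OF copB fin w(1,2) that] zero_mv_support[OF copB fin w(1,2) that]
    unfolding m_def by auto
  \<comment> \<open>The diagonal entry at \<open>v\<close> can stay: \<open>w v = 1\<close> and
    complementary slackness give \<open>m v = 0\<close>. For the same reason the amounts
    \<open>w j * m j\<close> removed from row \<open>v\<close> vanish, while every other row loses
    exactly \<open>m k * w v = m k\<close>.\<close>
  define P where "P = (\<lambda>i j. B i j - (if i = v \<and> j \<noteq> v then m j else 0) - (if j = v \<and> i \<noteq> v then m i else 0))"
  have "psd_on S P"
  proof (rule psd_on_extend[OF fin v])
    show "sym_on S P" using copB unfolding P_def cop_on_def sym_on_def by auto
    have "P i j = A i j" if "i \<in> ?T" "j \<in> ?T" for i j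
      using that unfolding P_def B_def unit_pair_def by auto
    then have "sym_on ?T P" "qf ?T P x = qf ?T A x" for x
      using psd qf_cong[of ?T P A x x] unfolding psd_on_def sym_on_def by auto
    then show "psd_on ?T P" using psd unfolding psd_on_def by simp
    show "w v = 1" by (rule w(3))
    fix k assume k: "k \<in> S"
    show "mv S P w k = 0"
    proof (cases "k = v")
      case True
      have "mv S P w k = (\<Sum>j\<in>S. B v j * w j - (if j = v then 0 else w j * m j))"
        unfolding mv_def True P_def by (intro sum.cong) (auto simp: algebra_simps)
      also have "\<dots> = m v" unfolding m_def mv_def using m0(2) by (intro sum.cong) (auto simp: m_def mv_def)
      finally show ?thesis using m0(2)[OF v] w(3) by (simp add: True)
    next
      case False
      have "mv S P w k = (\<Sum>j\<in>S. B k j * w j - (if j = v then m k else 0))"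
        unfolding mv_def P_def using False w(3) by (intro sum.cong) (auto simp: algebra_simps)
      also have "\<dots> = m k - m k" unfolding sum_subtractf using fin v by (simp add: m_def mv_def)
      finally show ?thesis by simp
    qed
  qed
  moreover have "P i j \<le> A i j" if "i \<in> S" "j \<in> S" for i j
    using m0(1)[OF that(1)] m0(1)[OF that(2)] d unfolding P_def B_def unit_pair_def by auto
  ultimately show ?thesis unfolding spn_on_def by blast
qed

lemma psd_on_add_diag:
  assumes "psd_on S A" "finite S" "0 \<le> e"
  shows "psd_on S (add_diag e A)"
  using assms sym_on_add_diag unfolding psd_on_def
  by (auto simp: qf_add_diag intro!: add_nonneg_nonneg mult_nonneg_nonneg sum_nonneg)

lemma psd_minor_imp_spn:
  assumes A: "cop_on S A" and fin: "finite S" and v: "v \<in> S" and psd: "psd_on (S - {v}) A"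
  shows "spn_on S A"
proof (rule spn_on_closed[OF fin])
  fix e :: real assume e: "e > 0"
  show "spn_on S (add_diag e A)"
    by (rule psd_minor_imp_spn_strict[OF cop_add_diag_scop[OF A fin e] fin v])
      (use psd_on_add_diag[OF psd] fin e in auto)
qed

text \<open>The counting criterion behind all later cases. If the support misses one index, the form
  on the support is a semidefinite minor of codimension one.\<close>

lemma zero_imp_spn:
  assumes A: "cop_on S A" and fin: "finite S" and u: "\<forall>i\<in>S. 0 \<le> u i" "qf S A u = 0"
    and card: "card S \<le> Suc (card {i \<in> S. u i \<noteq> 0})"
  shows "spn_on S A"
proof (cases "{i \<in> S. u i \<noteq> 0} = S")
  case True
  then show ?thesis using zero_support_psd[OF A fin u] psd_imp_spn by auto
next
  case False
  let ?J = "{i \<in> S. u i \<noteq> 0}"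
  have "card (S - ?J) = card S - card ?J" using fin by (intro card_Diff_subset) auto
  moreover have "card (S - ?J) > 0" using False fin by (auto simp: card_gt_0_iff)
  ultimately have "card (S - ?J) = 1" using card by linarith
  then obtain v where v: "S - ?J = {v}" by (rule card_1_singletonE)
  then have J: "S - {v} = ?J" "v \<in> S" by blast+
  have "psd_on (S - {v}) A" unfolding J(1) by (rule zero_support_psd[OF A fin u])
  then show ?thesis by (rule psd_minor_imp_spn[OF A fin J(2)])
qed

lemma zero_card_imp_spn:
  assumes "cop_on S A" "finite S" "\<forall>i\<in>S. 0 \<le> u i" "qf S A u = 0"
    and "T \<subseteq> S" "\<And>i. i \<in> T \<Longrightarrow> u i \<noteq> 0" "card S \<le> Suc (card T)"
  shows "spn_on S A"
proof (rule zero_imp_spn[OF assms(1-4)])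
  have "card T \<le> card {i \<in> S. u i \<noteq> 0}"
    using assms by (intro card_mono) auto
  then show "card S \<le> Suc (card {i \<in> S. u i \<noteq> 0})" using assms(7) by linarith
qed

text \<open>Either the full amount \<open>m\<close> can be subtracted with strictness intact, or the
  subtraction stops at a zero that meets \<open>D\<close>. Adding \<open>d * D\<close> back only
  raises entries.\<close>

lemma spn_by_reduction:
  assumes fin: "finite S" and A: "scop_on S A" and D: "sym_on S D"
    and nn: "\<And>i j. i \<in> S \<Longrightarrow> j \<in> S \<Longrightarrow> 0 \<le> D i j" and m: "0 \<le> m"
    and strict: "scop_on S (\<lambda>i j. A i j - m * D i j) \<Longrightarrow> spn_on S (\<lambda>i j. A i j - m * D i j)"
    and zero: "\<And>d u. 0 \<le> d \<Longrightarrow> d \<le> m \<Longrightarrow> cop_on S (\<lambda>i j. A i j - d * D i j) \<Longrightarrow> \<forall>i\<in>S. 0 \<le> u i \<Longrightarrow>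
      qf S (\<lambda>i j. A i j - d * D i j) u = 0 \<Longrightarrow> qf S D u > 0 \<Longrightarrow> spn_on S (\<lambda>i j. A i j - d * D i j)"
  shows "spn_on S A"
proof -
  have "\<exists>d\<ge>0. spn_on S (\<lambda>i j. A i j - d * D i j)"
  proof (cases "scop_on S (\<lambda>i j. A i j - m * D i j)")
    case True
    then show ?thesis using strict m by (intro exI[of _ m] conjI)
  next
    case False
    obtain d u where d: "0 \<le> d" "d \<le> m" "cop_on S (\<lambda>i j. A i j - d * D i j)"
      and u: "\<forall>i\<in>S. 0 \<le> u i" "qf S (\<lambda>i j. A i j - d * D i j) u = 0" "qf S D u > 0"
      by (rule reduce_to_zero[OF fin A D nn m False])
    show ?thesis using zero[OF d u] d(1) by (intro exI[of _ d] conjI)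
  qed
  then obtain d where d: "d \<ge> 0" "spn_on S (\<lambda>i j. A i j - d * D i j)" by blast
  show ?thesis by (rule spn_on_mono[OF d(2)]) (use d(1) nn in auto)
qed

text \<open>Two support indices come for free, so in five variables two further ones remain to be
  found, in four variables one.\<close>

lemma spn_by_pair_reduction:
  assumes fin: "finite S" and A: "scop_on S A" and ij: "i \<in> S" "j \<in> S" "i \<noteq> j" and m: "0 \<le> m"
    and strict: "scop_on S (\<lambda>k l. A k l - m * unit_pair i j k l) \<Longrightarrow>
      spn_on S (\<lambda>k l. A k l - m * unit_pair i j k l)"
    and zero: "\<And>d u. 0 \<le> d \<Longrightarrow> d \<le> m \<Longrightarrow> cop_on S (\<lambda>k l. A k l - d * unit_pair i j k l) \<Longrightarrow>
      \<forall>k\<in>S. 0 \<le> u k \<Longrightarrow> qf S (\<lambda>k l. A k l - d * unit_pair i j k l) u = 0 \<Longrightarrow> u i > 0 \<Longrightarrow> u j > 0 \<Longrightarrow>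
      spn_on S (\<lambda>k l. A k l - d * unit_pair i j k l)"
  shows "spn_on S A"
proof (rule spn_by_reduction[OF fin A sym_on_unit_pair _ m strict])
  fix d and u :: "'a \<Rightarrow> real"
  assume d: "0 \<le> d" "d \<le> m" "cop_on S (\<lambda>k l. A k l - d * unit_pair i j k l)"
    and u: "\<forall>k\<in>S. 0 \<le> u k" "qf S (\<lambda>k l. A k l - d * unit_pair i j k l) u = 0" "qf S (unit_pair i j) u > 0"
  have "u i > 0" "u j > 0"
    using u(1,3) ij unfolding qf_unit_pair[OF fin ij] by (auto simp: less_le)
  then show "spn_on S (\<lambda>k l. A k l - d * unit_pair i j k l)" by (rule zero[OF d u(1,2)])
qed (rule unit_pair_nonneg)

section \<open>Copositive forms in at most four variables\<close>

text \<open>Replacing \<open>x\<close> by its absolute value can only lower the form when the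
  off-diagonal entries are nonpositive.\<close>

lemma cop_offdiag_nonpos_psd:
  assumes A: "cop_on S A" and neg: "\<And>i j. i \<in> S \<Longrightarrow> j \<in> S \<Longrightarrow> i \<noteq> j \<Longrightarrow> A i j \<le> 0"
  shows "psd_on S A"
proof -
  have "0 \<le> qf S A x" for x
  proof -
    have "0 \<le> qf S A (\<lambda>i. \<bar>x i\<bar>)" by (intro cop_onD[OF A]) auto
    also have "\<dots> \<le> qf S A x" unfolding qf_alt
    proof (intro sum_mono)
      fix i j assume ij: "i \<in> S" "j \<in> S"
      show "A i j * \<bar>x i\<bar> * \<bar>x j\<bar> \<le> A i j * x i * x j"
      proof (cases "i = j")
        case False
        have "A i j * \<bar>x i * x j\<bar> \<le> A i j * (x i * x j)"
          using neg[OF ij False] by (intro mult_left_mono_neg) auto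
        then show ?thesis by (simp add: abs_mult mult.assoc)
      qed (simp add: mult.assoc)
    qed
    finally show ?thesis .
  qed
  then show ?thesis using A unfolding psd_on_def cop_on_def by blast
qed

lemma scop_card_le_4_spn:
  assumes "finite S" "card S \<le> 4" "scop_on S A"
  shows "spn_on S A"
  using assms
proof (induction "card {(i, j) \<in> S \<times> S. i \<noteq> j \<and> A i j > 0}" arbitrary: A rule: less_induct)
  case less
  note fin = less.prems(1) and A = less.prems(3)
  let ?pos = "\<lambda>A :: 'a \<Rightarrow> 'a \<Rightarrow> real. {(i, j) \<in> S \<times> S. i \<noteq> j \<and> A i j > 0}"
  show ?case
  proof (cases "?pos A = {}")
    case True
    then have "A i j \<le> 0" if "i \<in> S" "j \<in> S" "i \<noteq> j" for i j
      using that by (auto simp: not_less)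
    then show ?thesis
      using psd_imp_spn cop_offdiag_nonpos_psd[OF scop_imp_cop[OF A]] by blast
  next
    case False
    then obtain i j where ij: "i \<in> S" "j \<in> S" "i \<noteq> j" "A i j > 0" by auto
    have sym: "A j i = A i j" using A ij unfolding scop_on_def sym_on_def by blast
    show ?thesis
    proof (rule spn_by_pair_reduction[OF fin A ij(1-3), of "A i j"])
      let ?B = "\<lambda>k l. A k l - A i j * unit_pair i j k l"
      assume B: "scop_on S ?B"
      have "?pos ?B \<subset> ?pos A"
      proof
        show "?pos ?B \<subseteq> ?pos A" using ij by (auto simp: unit_pair_def split: if_splits)
        have "(i, j) \<in> ?pos A" "(i, j) \<notin> ?pos ?B" using ij by (auto simp: unit_pair_def)
        then show "?pos ?B \<noteq> ?pos A" by blast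
      qed
      moreover have "finite (?pos A)" by (rule finite_subset[of _ "S \<times> S"]) (use fin in auto)
      ultimately have "card (?pos ?B) < card (?pos A)" by (rule psubset_card_mono[rotated])
      then show "spn_on S ?B" by (rule less.hyps[OF _ fin less.prems(2) B])
    next
      fix d u
      let ?B = "\<lambda>k l. A k l - d * unit_pair i j k l"
      assume d: "0 \<le> d" "d \<le> A i j" and B: "cop_on S ?B" and u: "\<forall>k\<in>S. 0 \<le> u k" "qf S ?B u = 0"
        and uij: "u i > 0" "u j > 0"
      \<comment> \<open>The lowered entry is still nonnegative and the diagonal is positive, so no
        zero lives on \<open>{i, j}\<close> alone; a third support index is enough for four
        variables.\<close>
      have "\<exists>k\<in>S - {i, j}. u k \<noteq> 0"
      proof (rule ccontr)
        assume "\<not> ?thesis"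
        then have "qf S ?B u = ?B i i * (u i)\<^sup>2 + ?B j j * (u j)\<^sup>2 + (?B i j + ?B j i) * u i * u j"
          by (intro qf_pair[OF fin ij(1-3)]) auto
        moreover have "0 < ?B i i * (u i)\<^sup>2"
          using scop_diag_pos[OF A fin ij(1)] ij uij by (simp add: unit_pair_def)
        moreover have "0 < ?B j j * (u j)\<^sup>2"
          using scop_diag_pos[OF A fin ij(2)] ij uij by (simp add: unit_pair_def)
        moreover have "0 \<le> (?B i j + ?B j i) * u i * u j"
          using d uij ij sym by (simp add: unit_pair_def)
        ultimately show False using u(2) by linarith
      qed
      then obtain k where k: "k \<in> S" "k \<noteq> i" "k \<noteq> j" "u k \<noteq> 0" by blast
      show "spn_on S ?B"
      proof (rule zero_card_imp_spn[OF B fin u])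
        show "{i, j, k} \<subseteq> S" using ij k by auto
        show "u l \<noteq> 0" if "l \<in> {i, j, k}" for l using that uij k by auto
        show "card S \<le> Suc (card {i, j, k})" using less.prems(2) ij k by simp
      qed
    qed (use ij in auto)
  qed
qed

theorem cop_card_le_4_spn:
  assumes "finite S" "card S \<le> 4" "cop_on S A"
  shows "spn_on S A"
  by (rule spn_on_closed[OF assms(1)], rule scop_card_le_4_spn[OF assms(1,2)],
      rule cop_add_diag_scop[OF assms(3,1)])

section \<open>Rows of constant sign and direct sums\<close>

lemma spn_on_disjoint_union:
  assumes fin: "finite S" "finite T" and disj: "S \<inter> T = {}" and sym: "sym_on (S \<union> T) A"
    and spn: "spn_on S A" "spn_on T A" and nn: "\<And>i j. i \<in> S \<Longrightarrow> j \<in> T \<Longrightarrow> 0 \<le> A i j"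
  shows "spn_on (S \<union> T) A"
proof -
  obtain P where P: "psd_on S P" "\<And>i j. i \<in> S \<Longrightarrow> j \<in> S \<Longrightarrow> P i j \<le> A i j"
    using spn(1) unfolding spn_on_def by blast
  obtain Q where Q: "psd_on T Q" "\<And>i j. i \<in> T \<Longrightarrow> j \<in> T \<Longrightarrow> Q i j \<le> A i j"
    using spn(2) unfolding spn_on_def by blast
  define R where "R = (\<lambda>i j. if i \<in> S \<and> j \<in> S then P i j else if i \<in> T \<and> j \<in> T then Q i j else 0)"
  have symR: "sym_on (S \<union> T) R" using P Q disj unfolding R_def psd_on_def sym_on_def by auto
  have "0 \<le> qf (S \<union> T) R x" for x
  proof -
    have "(\<Sum>i\<in>S. \<Sum>j\<in>T. R i j * x i * x j) = 0"
      using disj unfolding R_def by (intro sum.neutral ballI) auto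
    moreover have "qf S R x = qf S P x" by (rule qf_cong) (auto simp: R_def)
    moreover have "qf T R x = qf T Q x" by (rule qf_cong) (use disj in \<open>auto simp: R_def\<close>)
    ultimately show ?thesis
      using qf_union[OF fin disj symR, of x] P(1) Q(1) unfolding psd_on_def by simp
  qed
  then have "psd_on (S \<union> T) R" using symR unfolding psd_on_def by blast
  moreover have "R i j \<le> A i j" if "i \<in> S \<union> T" "j \<in> S \<union> T" for i j
  proof -
    have "A j i = A i j" using sym that unfolding sym_on_def by blast
    then show ?thesis using that P(2) Q(2) nn[of i j] nn[of j i] disj unfolding R_def by auto
  qed
  ultimately show ?thesis unfolding spn_on_def by blast
qed

lemma spn_on_nonneg_row:
  assumes fin: "finite S" and v: "v \<in> S" and A: "cop_on S A" and spn: "spn_on (S - {v}) A"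
    and nn: "\<And>j. j \<in> S - {v} \<Longrightarrow> 0 \<le> A v j"
  shows "spn_on S A"
proof -
  have S: "{v} \<union> (S - {v}) = S" using v by blast
  have "cop_on {v} A" by (rule cop_on_subset[OF A]) (use v fin in auto)
  then have "spn_on {v} A" by (intro cop_card_le_4_spn) auto
  then have "spn_on ({v} \<union> (S - {v})) A"
    by (intro spn_on_disjoint_union) (use S fin A spn nn in \<open>auto simp: cop_on_def insert_absorb[OF v]\<close>)
  then show ?thesis by (simp only: S)
qed

text \<open>\<open>B\<close> is the Schur complement at \<open>v\<close>. It inherits copositivity
  because the minimising value of the coordinate \<open>v\<close> is nonnegative when row
  \<open>v\<close> is nonpositive. Adding the rank-one form \<open>(1 / a) * C\<close> to a
  semidefinite part of \<open>B\<close> reproduces row \<open>v\<close> of \<open>A\<close>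
  exactly.\<close>

lemma spn_on_nonpos_row:
  assumes fin: "finite S" and v: "v \<in> S" and A: "scop_on S A"
    and neg: "\<And>j. j \<in> S - {v} \<Longrightarrow> A v j \<le> 0"
    and spn: "\<And>B. cop_on (S - {v}) B \<Longrightarrow> spn_on (S - {v}) B"
  shows "spn_on S A"
proof -
  let ?T = "S - {v}"
  have sym: "sym_on S A" using A unfolding scop_on_def by blast
  define a where "a = A v v"
  have a: "a > 0" unfolding a_def by (rule scop_diag_pos[OF A fin v])
  define C where "C = (\<lambda>i j. A v i * A v j)"
  have qfC: "qf T C x = (\<Sum>i\<in>T. A v i * x i)\<^sup>2" for T x
    unfolding qf_alt C_def power2_eq_square sum_product by (intro sum.cong refl) simp
  define B where "B = (\<lambda>i j. A i j - (1 / a) * C i j)"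
  have "cop_on ?T B"
    unfolding cop_on_def
  proof (intro conjI allI impI)
    show "sym_on ?T B" using sym unfolding sym_on_def B_def C_def by (auto simp: mult.commute)
    fix x :: "'a \<Rightarrow> real" assume x: "\<forall>i\<in>?T. 0 \<le> x i"
    define s where "s = (\<Sum>j\<in>?T. A v j * x j)"
    have s: "s \<le> 0" unfolding s_def using x neg by (intro sum_nonpos mult_nonpos_nonneg) auto
    \<comment> \<open>This is the minimiser of the quadratic in coordinate \<open>v\<close>, with
      minimum value \<open>qf ?T B x\<close>.\<close>
    define y where "y = x(v := - s / a)"
    have "\<forall>i\<in>S. 0 \<le> y i" using x s a unfolding y_def by (auto simp: divide_nonpos_pos)
    then have "0 \<le> qf S A y" by (rule cop_onD[OF scop_imp_cop[OF A]])
    also have "qf S A y = a * (y v)\<^sup>2 + 2 * y v * mv ?T A y v + qf ?T A y"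
      unfolding a_def by (rule qf_split[OF fin v sym])
    also have "mv ?T A y v = s" unfolding mv_def s_def y_def by (intro sum.cong) auto
    also have "qf ?T A y = qf ?T A x" by (rule qf_cong) (auto simp: y_def)
    also have "a * (y v)\<^sup>2 + 2 * y v * s + qf ?T A x = qf ?T B x"
      unfolding B_def qf_diff_matrix qfC s_def[symmetric] using a
      by (simp add: y_def power2_eq_square field_simps)
    finally show "0 \<le> qf ?T B x" .
  qed
  then obtain Q where Q: "psd_on ?T Q" "\<And>i j. i \<in> ?T \<Longrightarrow> j \<in> ?T \<Longrightarrow> Q i j \<le> B i j"
    using spn unfolding spn_on_def by blast
  define R where "R = (\<lambda>i j. if i = v \<or> j = v then 0 else Q i j)"
  define P where "P = (\<lambda>i j. R i j + (1 / a) * C i j)"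
  have "psd_on S P"
    unfolding psd_on_def
  proof (intro conjI allI)
    have "sym_on S R" using Q(1) unfolding R_def psd_on_def sym_on_def by auto
    then show "sym_on S P" unfolding P_def C_def sym_on_def by (auto simp: mult.commute)
    fix x :: "'a \<Rightarrow> real"
    have "sym_on S R" using Q(1) unfolding R_def psd_on_def sym_on_def by auto
    then have "qf S R x = qf ?T R x" using qf_split[OF fin v, of R x] by (simp add: R_def mv_def)
    also have "\<dots> = qf ?T Q x" by (rule qf_cong) (auto simp: R_def)
    finally have "0 \<le> qf S R x" using Q(1) unfolding psd_on_def by simp
    then show "0 \<le> qf S P x" unfolding P_def qf_add_matrix qfC using a by simp
  qed
  moreover have "P i j \<le> A i j" if "i \<in> S" "j \<in> S" for i j
  proof (cases "i = v \<or> j = v")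
    case True
    have "A j i = A i j" using sym that unfolding sym_on_def by blast
    then show ?thesis using True a unfolding P_def R_def C_def by (auto simp: a_def)
  next
    case False
    then show ?thesis using Q(2)[of i j] that unfolding P_def R_def B_def by simp
  qed
  ultimately show ?thesis unfolding spn_on_def by blast
qed

lemma card_5_nonneg_row_spn:
  assumes "finite S" "card S = 5" "v \<in> S" "cop_on S A" "\<And>j. j \<in> S - {v} \<Longrightarrow> 0 \<le> A v j"
  shows "spn_on S A"
proof (rule spn_on_nonneg_row[OF assms(1,3,4) _ assms(5)])
  show "spn_on (S - {v}) A"
    by (rule cop_card_le_4_spn) (use assms cop_on_subset[OF assms(4), of "S - {v}"] in auto)
qed

lemma card_5_nonpos_row_spn:
  assumes "finite S" "card S = 5" "v \<in> S" "scop_on S A" "\<And>j. j \<in> S - {v} \<Longrightarrow> A v j \<le> 0"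
  shows "spn_on S A"
proof (rule spn_on_nonpos_row[OF assms(1,3,4,5)])
  show "spn_on (S - {v}) B" if "cop_on (S - {v}) B" for B
    by (rule cop_card_le_4_spn) (use assms that in auto)
qed

section \<open>Zero patterns in five variables\<close>

text \<open>Here \<open>b\<close> subdivides the edge \<open>d e\<close> of a complete graph on
  \<open>a\<close>, \<open>c\<close>, \<open>d\<close>, \<open>e\<close>. Lower the entry at
  \<open>b\<close>, \<open>e\<close>: at 0 the row of \<open>b\<close> is nonpositive. At an earlier
  zero, row \<open>b\<close> can only be balanced by \<open>u d\<close>, and row \<open>e\<close>,
  where \<open>A e d = 0\<close>, only by \<open>u a\<close> or \<open>u c\<close>; this makes four
  support indices.\<close>

lemma subdivided_K4_mixed_spn:
  assumes S: "S = {a, b, c, d, e}" and dist: "distinct [a, b, c, d, e]" and A: "scop_on S A"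
    and zeros: "A b a = 0" "A b c = 0" "A e d = 0" and signs: "A b d < 0" "0 < A b e"
  shows "spn_on S A"
proof -
  have fin: "finite S" and card: "card S = 5" using S dist by auto
  show ?thesis
  proof (rule spn_by_pair_reduction[OF fin A, of b e "A b e"])
    let ?B = "\<lambda>k l. A k l - A b e * unit_pair b e k l"
    assume B: "scop_on S ?B"
    show "spn_on S ?B"
      by (rule card_5_nonpos_row_spn[OF fin card _ B, of b])
        (use S dist zeros signs in \<open>auto simp: unit_pair_def\<close>)
  next
    fix t and u :: "'a \<Rightarrow> real"
    let ?B = "\<lambda>k l. A k l - t * unit_pair b e k l"
    assume t: "0 \<le> t" "t \<le> A b e" and B: "cop_on S ?B" and u: "\<forall>k\<in>S. 0 \<le> u k" "qf S ?B u = 0"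
      and ub: "u b > 0" and ue: "u e > 0"
    have sym: "A e b = A b e" using A S unfolding scop_on_def sym_on_def by blast
    have diag: "A b b > 0" "A e e > 0" using scop_diag_pos[OF A fin] S by auto
    have pos: "0 \<le> u a" "0 \<le> u c" "0 \<le> u d" using u S by auto
    have "mv S ?B u b = 0" "mv S ?B u e = 0"
      using zero_mv_support[OF B fin u, of b] zero_mv_support[OF B fin u, of e] ub ue S by auto
    then have row_b: "A b b * u b + A b d * u d + (A b e - t) * u e = 0"
      and row_e: "A e a * u a + (A b e - t) * u b + A e c * u c + A e e * u e = 0"
      using dist zeros by (auto simp: S mv_def unit_pair_def sym algebra_simps)
    have "0 < A b b * u b" "0 < A e e * u e" using diag ub ue by auto
    moreover have "0 \<le> (A b e - t) * u e" "0 \<le> (A b e - t) * u b" using t ub ue by auto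
    ultimately have "A b d * u d \<noteq> 0" "A e a * u a + A e c * u c \<noteq> 0"
      using row_b row_e by linarith+
    then have "u d \<noteq> 0" "u a \<noteq> 0 \<or> u c \<noteq> 0" by auto
    then obtain k where k: "k \<in> {a, c}" "u k \<noteq> 0" by blast
    show "spn_on S ?B"
    proof (rule zero_card_imp_spn[OF B fin u])
      show "{b, d, e, k} \<subseteq> S" using k S by auto
      show "u l \<noteq> 0" if "l \<in> {b, d, e, k}" for l using that k ub ue \<open>u d \<noteq> 0\<close> by auto
      show "card S \<le> Suc (card {b, d, e, k})" using card k dist by auto
    qed
  qed (use S dist signs in auto)
qed

lemma subdivided_K4_spn:
  assumes S: "S = {a, b, c, d, e}" and dist: "distinct [a, b, c, d, e]" and A: "scop_on S A"
    and zeros: "A a b = 0" "A b c = 0" "A d e = 0"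
  shows "spn_on S A"
proof -
  have fin: "finite S" and card: "card S = 5" using S dist by auto
  have sym: "A b a = 0" "A e d = 0"
    using A S zeros unfolding scop_on_def sym_on_def by (metis insertCI)+
  have S': "S = {a, b, c, e, d}" using S by auto
  consider "0 \<le> A b d" "0 \<le> A b e" | "A b d \<le> 0" "A b e \<le> 0" | "A b d < 0" "0 < A b e" | "A b e < 0" "0 < A b d"
    by linarith
  then show ?thesis
  proof cases
    case 1
    show ?thesis
      by (rule card_5_nonneg_row_spn[OF fin card _ scop_imp_cop[OF A], of b])
        (use S 1 zeros sym in auto)
  next
    case 2
    show ?thesis
      by (rule card_5_nonpos_row_spn[OF fin card _ A, of b]) (use S 2 zeros sym in auto)
  next
    case 3
    then show ?thesis using subdivided_K4_mixed_spn[OF S dist A] zeros sym by simp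
  next
    case 4
    then show ?thesis using subdivided_K4_mixed_spn[OF S' _ A] dist zeros sym by auto
  qed
qed

text \<open>Lowering both positive entries proportionally keeps the rows of \<open>x\<close> and \<open>y\<close> proportional, so
  a zero meeting one of \<open>x\<close>, \<open>y\<close> meets both.\<close>

lemma T5_parallel_spn:
  assumes S: "S = {p, q, x, y, z}" and dist: "distinct [p, q, x, y, z]" and A: "scop_on S A"
    and zeros: "A x y = 0" "A x z = 0" "A y x = 0" "A y z = 0"
    and x: "A x p < 0" "0 < A x q" and y: "A y p < 0" "0 < A y q"
    and parallel: "A x p * A y q = A y p * A x q"
  shows "spn_on S A"
proof -
  have fin: "finite S" and card: "card S = 5" using S dist by auto
  \<comment> \<open>Subtracting \<open>t * D\<close> multiplies both positive entries by
    \<open>1 - t\<close>; at \<open>t = 1\<close> the row of \<open>x\<close> is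
    nonpositive.\<close>
  define D where "D = (\<lambda>k l. A x q * unit_pair x q k l + A y q * unit_pair y q k l)"
  have qfD: "qf S D u = 2 * A x q * u x * u q + 2 * A y q * u y * u q" for u
  proof -
    have "qf S D u = qf S (\<lambda>k l. A x q * unit_pair x q k l) u + A y q * qf S (unit_pair y q) u"
      unfolding D_def by (rule qf_add_matrix)
    moreover have "qf S (\<lambda>k l. A x q * unit_pair x q k l) u = A x q * qf S (unit_pair x q) u"
      using qf_add_matrix[of S "\<lambda>_ _. 0" "A x q" "unit_pair x q" u] by (simp add: qf_alt)
    moreover have "qf S (unit_pair x q) u = 2 * u x * u q" "qf S (unit_pair y q) u = 2 * u y * u q"
      by (intro qf_unit_pair[OF fin]; use S dist in auto)+
    ultimately show ?thesis by simp
  qed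
  show ?thesis
  proof (rule spn_by_reduction[OF fin A, of D 1])
    show "sym_on S D" unfolding D_def sym_on_def unit_pair_def by auto
    show "0 \<le> D k l" for k l unfolding D_def using x y
      by (intro add_nonneg_nonneg mult_nonneg_nonneg unit_pair_nonneg) auto
    let ?B = "\<lambda>k l. A k l - 1 * D k l"
    assume B: "scop_on S ?B"
    show "spn_on S ?B"
      by (rule card_5_nonpos_row_spn[OF fin card _ B, of x])
        (use S dist zeros x in \<open>auto simp: unit_pair_def D_def\<close>)
  next
    fix t and u :: "'a \<Rightarrow> real"
    let ?B = "\<lambda>k l. A k l - t * D k l"
    assume t: "0 \<le> t" "t \<le> 1" and B: "cop_on S ?B" and u: "\<forall>k\<in>S. 0 \<le> u k" "qf S ?B u = 0"
      and Du: "qf S D u > 0"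
    have diag: "A x x > 0" "A y y > 0" using scop_diag_pos[OF A fin] S by auto
    have pos: "0 \<le> u p" "0 \<le> u q" "0 \<le> u x" "0 \<le> u y" using u S by auto
    define r where "r = 1 - t"
    have r: "r \<ge> 0" using t r_def by simp
    have mv: "mv S ?B u x = A x x * u x + (A x p * u p + r * A x q * u q)"
      "mv S ?B u y = A y y * u y + (A y p * u p + r * A y q * u q)"
      using dist zeros by (auto simp: S mv_def unit_pair_def D_def r_def algebra_simps)
    have row: "0 \<le> mv S ?B u x" "0 \<le> mv S ?B u y" "u x * mv S ?B u x = 0" "u y * mv S ?B u y = 0"
      using zero_mv_nonneg[OF B fin u] zero_mv_support[OF B fin u] S by auto
    have uq: "u q > 0" and uxy: "u x > 0 \<or> u y > 0"
      using Du pos unfolding qfD by (auto simp: less_le)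
    have par: "A x q * (A y p * u p + r * A y q * u q) = A y q * (A x p * u p + r * A x q * u q)"
      using parallel by (simp add: algebra_simps)
    define f where "f = A x p * u p + r * A x q * u q"
    define g where "g = A y p * u p + r * A y q * u q"
    have fg: "f < 0 \<longleftrightarrow> g < 0"
      using par x y unfolding f_def[symmetric] g_def[symmetric] by (metis mult_less_0_iff order_less_asym)
    have fneg: "f < 0"
    proof (cases "u x > 0")
      case True
      then have "A x x * u x + f = 0" using row(3) unfolding mv f_def by simp
      moreover have "A x x * u x > 0" using True diag by simp
      ultimately show ?thesis by linarith
    next
      case False
      then have uy: "u y > 0" using uxy by blast
      then have "A y y * u y + g = 0" using row(4) unfolding mv g_def by simp
      moreover have "A y y * u y > 0" using uy diag by simp
      ultimately show ?thesis using fg by linarith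
    qed
    \<comment> \<open>Rows \<open>x\<close> and \<open>y\<close> are nonnegative at the zero
      although \<open>f\<close> and \<open>g\<close> are negative, so neither diagonal term can
      vanish.\<close>
    have "u x \<noteq> 0" "u y \<noteq> 0"
      using row(1,2) fneg fg unfolding mv f_def[symmetric] g_def[symmetric] by auto
    moreover have "u p \<noteq> 0"
    proof
      assume "u p = 0"
      then have "f = r * A x q * u q" unfolding f_def by simp
      moreover have "0 \<le> r * A x q * u q" using r x uq by simp
      ultimately show False using fneg by linarith
    qed
    ultimately show "spn_on S ?B"
      by (intro zero_card_imp_spn[OF B fin u, of "{p, q, x, y}"]) (use S dist uq card in auto)
  qed auto
qed

text \<open>Lower \<open>A x q\<close> until the rows of \<open>x\<close> and \<open>y\<close> are proportional; while they are not, a zero with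
  \<open>u x > 0\<close> also has \<open>u y > 0\<close>.\<close>

lemma T5_same_type_ordered_spn:
  assumes S: "S = {p, q, x, y, z}" and dist: "distinct [p, q, x, y, z]" and A: "scop_on S A"
    and zeros: "A x y = 0" "A x z = 0" "A y x = 0" "A y z = 0"
    and x: "A x p < 0" "0 < A x q" and y: "A y p < 0" "0 < A y q"
    and order: "A y p * A x q \<le> A x p * A y q"
  shows "spn_on S A"
proof -
  have fin: "finite S" and card: "card S = 5" using S dist by auto
  \<comment> \<open>The ratio of the two rows at \<open>p\<close>. By \<open>order\<close> the ratio
    at \<open>q\<close> is at least \<open>c\<close>, so lowering \<open>A x q\<close> to
    \<open>c * A y q\<close> makes the rows proportional.\<close>
  define c where "c = A x p / A y p"
  have c: "c > 0" unfolding c_def using x y by (simp add: divide_neg_neg)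
  have cp: "c * A y p = A x p" unfolding c_def using y by simp
  have "A y p * A x q \<le> A y p * (c * A y q)" using order unfolding cp[symmetric] by (simp add: mult_ac)
  then have cq: "c * A y q \<le> A x q" using y by (simp add: mult_le_cancel_left)
  show ?thesis
  proof (rule spn_by_pair_reduction[OF fin A, of x q "A x q - c * A y q"])
    let ?B = "\<lambda>k l. A k l - (A x q - c * A y q) * unit_pair x q k l"
    assume B: "scop_on S ?B"
    have e: "?B x y = A x y" "?B x z = A x z" "?B y x = A y x" "?B y z = A y z" "?B x p = A x p"
      "?B x q = c * A y q" "?B y p = A y p" "?B y q = A y q"
      using dist by (auto simp: unit_pair_def)
    show "spn_on S ?B"
      by (rule T5_parallel_spn[OF S dist B]; unfold e) (use zeros x y c cp[symmetric] in auto)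
  next
    fix t and u :: "'a \<Rightarrow> real"
    let ?B = "\<lambda>k l. A k l - t * unit_pair x q k l"
    assume t: "0 \<le> t" "t \<le> A x q - c * A y q" and B: "cop_on S ?B"
      and u: "\<forall>k\<in>S. 0 \<le> u k" "qf S ?B u = 0" and ux: "u x > 0" and uq: "u q > 0"
    have diag: "A x x > 0" using scop_diag_pos[OF A fin] S by auto
    have mv: "mv S ?B u x = A x x * u x + (A x p * u p + (A x q - t) * u q)"
      "mv S ?B u y = A y y * u y + (A y p * u p + A y q * u q)"
      using dist zeros by (auto simp: S mv_def unit_pair_def algebra_simps)
    have row: "0 \<le> mv S ?B u y" "mv S ?B u x = 0"
      using zero_mv_nonneg[OF B fin u, of y] zero_mv_support[OF B fin u, of x] ux S by auto
    have "A x x * u x > 0" using diag ux by simp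
    then have neg: "A x p * u p + (A x q - t) * u q < 0" using row(2) unfolding mv by linarith
    \<comment> \<open>Until that point \<open>c\<close> times the off-diagonal part of row
      \<open>y\<close> is at most that of row \<open>x\<close>, which is negative; hence
      \<open>u y\<close> cannot vanish.\<close>
    have le: "c * A y q * u q \<le> (A x q - t) * u q" using t uq by (intro mult_right_mono) auto
    have "c * (A y p * u p + A y q * u q) < 0"
      using neg le unfolding cp[symmetric] by (simp add: algebra_simps)
    then have "A y p * u p + A y q * u q < 0" using c by (simp add: mult_less_0_iff)
    then have "u y \<noteq> 0" using row(1) unfolding mv by auto
    moreover have "u p \<noteq> 0"
    proof
      assume "u p = 0"
      then have "(A x q - t) * u q < 0" using neg by simp
      moreover have "0 \<le> c * A y q * u q" using c y uq by simp
      ultimately show False using le by linarith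
    qed
    ultimately show "spn_on S ?B"
      by (intro zero_card_imp_spn[OF B fin u, of "{p, q, x, y}"]) (use S dist ux uq card in auto)
  qed (use S dist cq in auto)
qed

lemma T5_same_type_spn:
  assumes S: "S = {p, q, x, y, z}" and dist: "distinct [p, q, x, y, z]" and A: "scop_on S A"
    and zeros: "A x y = 0" "A x z = 0" "A y x = 0" "A y z = 0"
    and x: "A x p < 0" "0 < A x q" and y: "A y p < 0" "0 < A y q"
  shows "spn_on S A"
proof (cases "A y p * A x q \<le> A x p * A y q")
  case True
  then show ?thesis by (rule T5_same_type_ordered_spn[OF assms])
next
  case False
  have S': "S = {p, q, y, x, z}" using S by auto
  show ?thesis by (rule T5_same_type_ordered_spn[OF S']) (use assms False in auto)
qed

text \<open>Three triangles on the common edge \<open>p q\<close>. If none of the rows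
  \<open>x\<close>, \<open>y\<close>, \<open>z\<close> has constant sign, each is negative at one of
  \<open>p\<close>, \<open>q\<close> and positive at the other, and by pigeonhole two of them
  agree.\<close>

lemma T5_spn:
  assumes S: "S = {p, q, x, y, z}" and dist: "distinct [p, q, x, y, z]" and A: "scop_on S A"
    and zeros: "A x y = 0" "A x z = 0" "A y z = 0"
  shows "spn_on S A"
proof -
  have fin: "finite S" and card: "card S = 5" using S dist by auto
  have sym: "A y x = 0" "A z x = 0" "A z y = 0"
    using A S zeros unfolding scop_on_def sym_on_def by (metis insertCI)+
  have same: "spn_on S A"
    if "{p', q'} = {p, q}" "{v, w, r} = {x, y, z}" "distinct [v, w, r]"
      "A v p' < 0" "0 < A v q'" "A w p' < 0" "0 < A w q'" for p' q' v w r
  proof -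
    have "p' \<noteq> q'" using that by auto
    moreover have "S = {p', q'} \<union> {v, w, r}" unfolding that S by auto
    moreover have "{p', q'} \<inter> {v, w, r} = {}" unfolding that using dist by auto
    moreover have "A i j = 0" if "i \<in> {v, w, r}" "j \<in> {v, w, r}" "i \<noteq> j" for i j
      using that zeros sym unfolding \<open>{v, w, r} = {x, y, z}\<close> by auto
    ultimately show ?thesis
      using that by (intro T5_same_type_spn[of S p' q' v w r, OF _ _ A]) auto
  qed
  have row: "spn_on S A" if "v \<in> {x, y, z}" "0 \<le> A v p \<and> 0 \<le> A v q \<or> A v p \<le> 0 \<and> A v q \<le> 0" for v
    using that(2)
  proof
    assume "0 \<le> A v p \<and> 0 \<le> A v q"
    then show ?thesis
      by (intro card_5_nonneg_row_spn[OF fin card _ scop_imp_cop[OF A], of v])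
        (use S that(1) zeros sym in auto)
  next
    assume "A v p \<le> 0 \<and> A v q \<le> 0"
    then show ?thesis
      by (intro card_5_nonpos_row_spn[OF fin card _ A, of v]) (use S that(1) zeros sym in auto)
  qed
  show ?thesis
  proof (rule ccontr)
    assume no: "\<not> spn_on S A"
    have mixed: "A v p < 0 \<and> 0 < A v q \<or> A v q < 0 \<and> 0 < A v p" if "v \<in> {x, y, z}" for v
      using row[OF that] no by linarith
    have d: "distinct [x, y, z]" "distinct [x, z, y]" "distinct [y, z, x]" using dist by auto
    have s: "{x, z, y} = {x, y, z}" "{y, z, x} = {x, y, z}" "{q, p} = {p, q}" by auto
    show False
      using mixed[of x] mixed[of y] mixed[of z] no
        same[OF refl refl d(1)] same[OF refl s(1) d(2)] same[OF refl s(2) d(3)]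
        same[OF s(3) refl d(1)] same[OF s(3) s(1) d(2)] same[OF s(3) s(2) d(3)]
      by auto
  qed
qed

text \<open>Two triangles sharing \<open>o'\<close>. Unless row \<open>a\<close> or \<open>b\<close>
  has constant sign, \<open>A a o'\<close> and \<open>A b o'\<close> have the same strict sign. If
  both are positive, the form splits into \<open>{a, b}\<close> and the rest. If both are negative,
  then \<open>A a b > 0\<close>, and either \<open>o'\<close> is nonnegative towards
  \<open>c\<close> and \<open>d\<close>, which splits off \<open>{c, d}\<close>, or
  \<open>A a b\<close> is lowered: at a zero, row \<open>a\<close> forces \<open>u o'\<close>, and a
  negative entry of \<open>o'\<close> at \<open>c\<close> or \<open>d\<close> forces a fourth
  support index.\<close>

lemma bowtie_spn:
  assumes S: "S = {o', a, b, c, d}" and dist: "distinct [o', a, b, c, d]" and A: "scop_on S A"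
    and zeros: "A a c = 0" "A a d = 0" "A b c = 0" "A b d = 0"
  shows "spn_on S A"
proof -
  have fin: "finite S" and card: "card S = 5" using S dist by auto
  have symA: "sym_on S A" using A unfolding scop_on_def by blast
  have sym: "A c a = 0" "A d a = 0" "A c b = 0" "A d b = 0" "A b a = A a b" "A o' a = A a o'"
      "A o' b = A b o'" "A c o' = A o' c" "A d o' = A o' d"
    using symA S zeros unfolding sym_on_def by (metis insertCI)+
  have parts: "spn_on T A" if "T \<subseteq> S" "card T \<le> 4" for T
    by (rule cop_card_le_4_spn)
      (use that fin finite_subset cop_on_subset[OF scop_imp_cop[OF A]] in auto)
  have union: "spn_on S A" if "S = T \<union> U" "T \<inter> U = {}" "card T \<le> 4" "card U \<le> 4"
    "\<And>i j. i \<in> T \<Longrightarrow> j \<in> U \<Longrightarrow> 0 \<le> A i j" for T U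
  proof -
    have "finite T" "finite U" using that fin by auto
    then have "spn_on (T \<union> U) A"
      using parts that symA by (intro spn_on_disjoint_union) auto
    then show ?thesis using that by simp
  qed
  have row: "spn_on S A" if "v \<in> {a, b}" "0 \<le> A v o' \<and> 0 \<le> A a b \<or> A v o' \<le> 0 \<and> A a b \<le> 0" for v
    using that(2)
  proof
    assume "0 \<le> A v o' \<and> 0 \<le> A a b"
    then show ?thesis
      by (intro card_5_nonneg_row_spn[OF fin card _ scop_imp_cop[OF A], of v])
        (use S that(1) zeros sym in auto)
  next
    assume "A v o' \<le> 0 \<and> A a b \<le> 0"
    then show ?thesis
      by (intro card_5_nonpos_row_spn[OF fin card _ A, of v]) (use S that(1) zeros sym in auto)
  qed
  consider "\<exists>v\<in>{a, b}. 0 \<le> A v o' \<and> 0 \<le> A a b \<or> A v o' \<le> 0 \<and> A a b \<le> 0"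
    | "0 < A a o'" "0 < A b o'" | "A a o' < 0" "A b o' < 0" "0 < A a b"
    by force
  then show ?thesis
  proof cases
    case 1
    then show ?thesis using row by blast
  next
    case 2
    show ?thesis
      by (rule union[of "{a, b}" "{o', c, d}"]) (use S dist 2 zeros in auto)
  next
    case 3
    show ?thesis
    proof (cases "0 \<le> A o' c \<and> 0 \<le> A o' d")
      case True
      show ?thesis
        by (rule union[of "{o', a, b}" "{c, d}"]) (use S dist True zeros in auto)
    next
      case False
      show ?thesis
      proof (rule spn_by_pair_reduction[OF fin A, of a b "A a b"])
        let ?B = "\<lambda>k l. A k l - A a b * unit_pair a b k l"
        assume B: "scop_on S ?B"
        show "spn_on S ?B"
          by (rule card_5_nonpos_row_spn[OF fin card _ B, of a])
            (use S dist zeros 3 in \<open>auto simp: unit_pair_def\<close>)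
      next
        fix t and u :: "'a \<Rightarrow> real"
        let ?B = "\<lambda>k l. A k l - t * unit_pair a b k l"
        assume t: "0 \<le> t" "t \<le> A a b" and B: "cop_on S ?B" and u: "\<forall>k\<in>S. 0 \<le> u k" "qf S ?B u = 0"
          and ua: "u a > 0" and ub: "u b > 0"
        have "A a a > 0" using scop_diag_pos[OF A fin] S by auto
        then have "0 < A a a * u a" using ua by simp
        moreover have "0 \<le> (A a b - t) * u b" using t ub by auto
        moreover have "mv S ?B u a = 0"
          using zero_mv_support[OF B fin u, of a] ua S by auto
        then have "A a o' * u o' + A a a * u a + (A a b - t) * u b = 0"
          using dist zeros by (auto simp: S mv_def unit_pair_def algebra_simps)
        ultimately have "A a o' * u o' \<noteq> 0" by linarith
        then have uo: "u o' \<noteq> 0" by auto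
        then have uo_pos: "u o' > 0" using u S by (auto simp: less_le)
        have "u c \<noteq> 0 \<or> u d \<noteq> 0"
        proof (rule ccontr)
          assume "\<not> ?thesis"
          moreover have "0 \<le> mv S ?B u c" "0 \<le> mv S ?B u d"
            using zero_mv_nonneg[OF B fin u] S by auto
          ultimately have "0 \<le> A o' c * u o'" "0 \<le> A o' d * u o'"
            using dist zeros sym by (auto simp: S mv_def unit_pair_def algebra_simps)
          then show False using False uo_pos by (auto simp: zero_le_mult_iff)
        qed
        then obtain k where k: "k \<in> {c, d}" "u k \<noteq> 0" by blast
        show "spn_on S ?B"
        proof (rule zero_card_imp_spn[OF B fin u])
          show "{o', a, b, k} \<subseteq> S" using k S by auto
          show "u l \<noteq> 0" if "l \<in> {o', a, b, k}" for l using that k ua ub uo by auto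
          show "card S \<le> Suc (card {o', a, b, k})" using card k dist by auto
        qed
      qed (use S dist 3 in auto)
    qed
  qed
qed

text \<open>With \<open>w\<close> as the only possible neighbour, the row of \<open>v\<close> cannot
  have mixed signs.\<close>

lemma pendant_spn:
  assumes S: "S = {v, w, a, b, c}" and dist: "distinct [v, w, a, b, c]" and A: "scop_on S A"
    and zeros: "A v a = 0" "A v b = 0" "A v c = 0"
  shows "spn_on S A"
proof -
  have fin: "finite S" and card: "card S = 5" using S dist by auto
  show ?thesis
  proof (cases "0 \<le> A v w")
    case True
    show ?thesis
      by (rule card_5_nonneg_row_spn[OF fin card _ scop_imp_cop[OF A], of v])
        (use S True zeros in auto)
  next
    case False
    show ?thesis
      by (rule card_5_nonpos_row_spn[OF fin card _ A, of v]) (use S False zeros in auto)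
  qed
qed

section \<open>The exceptional form on the fan\<close>

lemma F5_simps: "pverts F5 = {..<5}"
  "parcs F5 = {(0, 1), (1, 2), (2, 3), (4, 0), (4, 1), (4, 2), (4, 3),
    (1, 0), (2, 1), (3, 2), (0, 4), (1, 4), (2, 4), (3, 4)}"
  by (auto simp: F5_def Let_def)

text \<open>In the order 0, 1, 4, 2, 3 the entries are -1 next to the diagonal, 1 at distance two
  and 0 beyond. This is the Horn form of the 5-cycle with the three entries at non-edges of the fan
  replaced by 0.\<close>

definition fan_form :: "nat \<Rightarrow> nat \<Rightarrow> real" where
  "fan_form i j =
    (if i = j \<or> {i, j} \<in> {{0, 4}, {1, 2}, {3, 4}} then 1
     else if {i, j} \<in> {{0, 1}, {1, 4}, {2, 3}, {2, 4}} then -1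
     else 0)"

lemma lessThan_5: "{..<5} = {0, 1, 2, 3, 4 :: nat}"
  by auto

lemma fan_form_nonzero_iff: "i \<noteq> j \<Longrightarrow> fan_form i j \<noteq> 0 \<longleftrightarrow> (i, j) \<in> parcs F5"
  unfolding fan_form_def F5_simps by (auto simp: doubleton_eq_iff)

lemma fan_form_sym: "fan_form i j = fan_form j i"
proof -
  have "{i, j} = {j, i}" by auto
  then show ?thesis unfolding fan_form_def by (simp only: eq_commute[of i j])
qed

text \<open>If \<open>x0 \<le> x1\<close> or \<open>x3 \<le> x2\<close>, one of the positive
  products dominates \<open>x0 * x3\<close>. Otherwise, with \<open>p = x0 - x1\<close> and
  \<open>q = x3 - x2\<close>, the terms after the square sum to
  \<open>2 * x1 * x2 - 2 * p * q\<close>, and the square of \<open>p + q + x4\<close> absorbs the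
  negative one.\<close>

lemma fan_form_qf_nonneg:
  fixes x0 x1 x2 x3 x4 :: real
  assumes "0 \<le> x0" "0 \<le> x1" "0 \<le> x2" "0 \<le> x3" "0 \<le> x4"
  shows "0 \<le> (x0 - x1 - x2 + x3 + x4)\<^sup>2 + 2 * x0 * x2 + 2 * x1 * x3 - 2 * x0 * x3"
proof (cases "x0 \<le> x1 \<or> x3 \<le> x2")
  case True
  then have "x0 * x3 \<le> x1 * x3 \<or> x0 * x3 \<le> x0 * x2"
    using assms by (auto intro: mult_right_mono mult_left_mono)
  moreover have "0 \<le> x0 * x2" "0 \<le> x1 * x3" using assms by auto
  ultimately have "x0 * x3 \<le> x0 * x2 + x1 * x3" by linarith
  then show ?thesis
    using zero_le_power2[of "x0 - x1 - x2 + x3 + x4"] unfolding mult.assoc by linarith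
next
  case False
  define p q where "p = x0 - x1" and "q = x3 - x2"
  have pq: "p > 0" "q > 0" using False unfolding p_def q_def by auto
  have "(x0 - x1 - x2 + x3 + x4)\<^sup>2 + 2 * x0 * x2 + 2 * x1 * x3 - 2 * x0 * x3
     = p\<^sup>2 + q\<^sup>2 + x4\<^sup>2 + 2 * p * x4 + 2 * q * x4 + 2 * x1 * x2"
    unfolding p_def q_def by (simp add: power2_eq_square algebra_simps)
  also have "\<dots> \<ge> 0" using pq assms by (intro add_nonneg_nonneg mult_nonneg_nonneg) auto
  finally show ?thesis .
qed

section \<open>Extensions of the fan form to graphs with more edges\<close>

context
  fixes M :: "nat \<Rightarrow> nat \<Rightarrow> real"
  assumes sym: "\<And>i j. i < 5 \<Longrightarrow> j < 5 \<Longrightarrow> M i j = M j i"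
    and M: "\<And>i j. i < 5 \<Longrightarrow> j < 5 \<Longrightarrow> fan_form i j \<noteq> 0 \<Longrightarrow> M i j = fan_form i j"
      "\<And>i j. i < 5 \<Longrightarrow> j < 5 \<Longrightarrow> fan_form i j = 0 \<Longrightarrow> 0 \<le> M i j \<and> M i j \<le> 1 / 2"
begin

lemma fan_extension_entries:
  "M 0 0 = 1" "M 1 1 = 1" "M 2 2 = 1" "M 3 3 = 1" "M 4 4 = 1"
  "M 0 1 = -1" "M 1 0 = -1" "M 0 4 = 1" "M 4 0 = 1" "M 1 2 = 1" "M 2 1 = 1" "M 1 4 = -1" "M 4 1 = -1"
  "M 2 3 = -1" "M 3 2 = -1" "M 2 4 = -1" "M 4 2 = -1" "M 3 4 = 1" "M 4 3 = 1"
  "M 2 0 = M 0 2" "M 3 0 = M 0 3" "M 3 1 = M 1 3"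
  using M(1)[of 0 0] M(1)[of 1 1] M(1)[of 2 2] M(1)[of 3 3] M(1)[of 4 4] M(1)[of 0 1] M(1)[of 1 0]
    M(1)[of 0 4] M(1)[of 4 0] M(1)[of 1 2] M(1)[of 2 1] M(1)[of 1 4] M(1)[of 4 1] M(1)[of 2 3]
    M(1)[of 3 2] M(1)[of 2 4] M(1)[of 4 2] M(1)[of 3 4] M(1)[of 4 3] sym[of 2 0] sym[of 3 0] sym[of 3 1]
  by (simp_all add: fan_form_def doubleton_eq_iff)

lemma fan_extension_bounds: "0 \<le> M 0 2" "0 \<le> M 0 3" "0 \<le> M 1 3" "M 0 3 \<le> 1 / 2"
  using M(2)[of 0 2] M(2)[of 0 3] M(2)[of 1 3] by (simp_all add: fan_form_def doubleton_eq_iff)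

lemma fan_extension_cop: "cop_on {..<5} M"
  unfolding cop_on_def
proof (intro conjI allI impI)
  show "sym_on {..<5} M" using sym unfolding sym_on_def by auto
  fix x :: "nat \<Rightarrow> real" assume x: "\<forall>i\<in>{..<5}. 0 \<le> x i"
  then have pos: "0 \<le> x 0" "0 \<le> x 1" "0 \<le> x 2" "0 \<le> x 3" "0 \<le> x 4" by auto
  have "qf {..<5} M x = ((x 0 - x 1 - x 2 + x 3 + x 4)\<^sup>2 + 2 * x 0 * x 2 + 2 * x 1 * x 3 - 2 * x 0 * x 3)
      + 2 * M 0 2 * (x 0 * x 2) + 2 * M 0 3 * (x 0 * x 3) + 2 * M 1 3 * (x 1 * x 3)"
    unfolding qf_alt lessThan_5
    by (simp add: fan_extension_entries fan_extension_entries[unfolded One_nat_def]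
        power2_eq_square algebra_simps)
  also have "\<dots> \<ge> 0"
    using fan_form_qf_nonneg[OF pos] fan_extension_bounds pos
    by (intro add_nonneg_nonneg[of _ "2 * M 1 3 * _"] add_nonneg_nonneg[of _ "2 * M 0 3 * _"]
        add_nonneg_nonneg[of _ "2 * M 0 2 * _"]) auto
  finally show "0 \<le> qf {..<5} M x" .
qed

text \<open>The vectors \<open>e0 + e1\<close>, \<open>e1 + e4\<close>, \<open>e4 + e2\<close>, \<open>e2 + e3\<close> are zeros of \<open>M\<close>, hence lie in the
  kernel of the semidefinite part \<open>P\<close>; their alternating sum \<open>e0 - e3\<close> does too, which forces
  \<open>P 0 3 = P 0 0 = 1\<close>. The six vectors combining two of them turn this into one linear inequality
  (the parallelogram identity for four vectors).\<close>

lemma fan_extension_not_spn: "\<not> spn_on {..<5} M"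
proof
  assume "spn_on {..<5} M"
  then obtain P where P: "psd_on {..<5} P" and le: "\<And>i j. i \<in> {..<5} \<Longrightarrow> j \<in> {..<5} \<Longrightarrow> P i j \<le> M i j"
    unfolding spn_on_def by blast
  have s: "P j i = P i j" if "i < 5" "j < 5" for i j
    using P that unfolding psd_on_def sym_on_def by auto
  have q: "0 \<le> P 0 0 * a * a + P 1 1 * b * b + P 2 2 * c * c + P 3 3 * d * d + P 4 4 * e * e
     + 2 * (P 0 1 * a * b + P 0 2 * a * c + P 0 3 * a * d + P 0 4 * a * e + P 1 2 * b * c
     + P 1 3 * b * d + P 1 4 * b * e + P 2 3 * c * d + P 2 4 * c * e + P 3 4 * d * e)" for a b c d e
  proof -
    define x where "x = (\<lambda>i :: nat. [a, b, c, d, e] ! i)"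
    have x: "x 0 = a" "x 1 = b" "x (Suc 0) = b" "x 2 = c" "x 3 = d" "x 4 = e" by (simp_all add: x_def)
    have "0 \<le> qf {..<5} P x" by (rule psd_onD[OF P])
    then show ?thesis
      unfolding qf_alt lessThan_5
      by (simp add: x s[of 0 1] s[of 0 "Suc 0"] s[of 0 2] s[of 0 3] s[of 0 4] s[of 1 2] s[of 1 3] s[of 1 4]
          s[of "Suc 0" 2] s[of "Suc 0" 3] s[of "Suc 0" 4] s[of 2 3] s[of 2 4] s[of 3 4] algebra_simps)
  qed
  have "P 0 0 \<le> 1" "P 1 1 \<le> 1" "P 2 2 \<le> 1" "P 3 3 \<le> 1" "P 4 4 \<le> 1" "P 0 1 \<le> -1" "P 1 4 \<le> -1"
    "P 2 4 \<le> -1" "P 2 3 \<le> -1" "P 0 3 \<le> 1 / 2"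
    using le[of 0 0] le[of 1 1] le[of 2 2] le[of 3 3] le[of 4 4] le[of 0 1] le[of 1 4] le[of 2 4] le[of 2 3]
      le[of 0 3] fan_extension_bounds(4)
    by (simp_all add: fan_extension_entries fan_extension_entries[unfolded One_nat_def])
  \<comment> \<open>The first two vectors give \<open>P 0 0 \<ge> 1\<close> and
    \<open>P 3 3 \<ge> 1\<close>. The other six are signed sums of two of the four zeros, with signs
    opposite to those in the alternating sum, and yield
    \<open>P 0 0 + P 3 3 \<le> 2 * P 0 3\<close>; so \<open>P 0 3\<close> would have to be at least
    1.\<close>
  then show False
    using q[of 1 1 0 0 0] q[of 0 0 1 1 0]
      q[of 1 2 0 0 1] q[of 1 1 "-1" 0 "-1"] q[of 1 1 1 1 0] q[of 0 1 1 0 2] q[of 0 1 "-1" "-1" 1] q[of 0 0 2 1 1]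
    by simp
qed

end

section \<open>Matrices, graphs and fans\<close>

abbreviation entries :: "real mat \<Rightarrow> nat \<Rightarrow> nat \<Rightarrow> real" where
  "entries A i j \<equiv> A $$ (i, j)"

lemma scalar_prod_mult_mat_vec_qf:
  assumes "A \<in> carrier_mat n n" "x \<in> carrier_vec n"
  shows "x \<bullet> (A *\<^sub>v x) = qf {..<n} (entries A) (\<lambda>i. x $ i)"
proof -
  have "(A *\<^sub>v x) $ i = mv {..<n} (entries A) (\<lambda>i. x $ i) i" if "i < n" for i
    using assms that by (simp add: scalar_prod_def mv_def atLeast0LessThan)
  then show ?thesis
    using assms by (simp add: scalar_prod_def qf_def atLeast0LessThan)
qed

lemma transpose_eq_imp_square:
  assumes "transpose_mat A = A"
  shows "A \<in> carrier_mat (dim_row A) (dim_row A)"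
  using assms by (metis carrier_matI index_transpose_mat(2))

lemma transpose_eq_iff_sym_on:
  assumes "A \<in> carrier_mat n n"
  shows "transpose_mat A = A \<longleftrightarrow> sym_on {..<n} (entries A)"
proof
  assume t: "transpose_mat A = A"
  have "A $$ (i, j) = A $$ (j, i)" if "i < n" "j < n" for i j
    using index_transpose_mat(1)[of j A i] t assms that by simp
  then show "sym_on {..<n} (entries A)" unfolding sym_on_def by auto
next
  assume "sym_on {..<n} (entries A)"
  then show "transpose_mat A = A"
    using assms unfolding sym_on_def by (intro eq_matI) auto
qed

lemma copositive_iff_cop_on:
  assumes A: "A \<in> carrier_mat n n"
  shows "copositive A \<longleftrightarrow> cop_on {..<n} (entries A)"
proof
  assume cop: "copositive A"
  have "0 \<le> qf {..<n} (entries A) f" if "\<forall>i\<in>{..<n}. 0 \<le> f i" for f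
  proof -
    have "0 \<le> vec n f \<bullet> (A *\<^sub>v vec n f)" using cop that A unfolding copositive_def by auto
    also have "\<dots> = qf {..<n} (entries A) (\<lambda>i. vec n f $ i)"
      by (rule scalar_prod_mult_mat_vec_qf[OF A]) simp
    also have "\<dots> = qf {..<n} (entries A) f" by (rule qf_cong) auto
    finally show ?thesis .
  qed
  then show "cop_on {..<n} (entries A)"
    using cop transpose_eq_iff_sym_on[OF A] unfolding copositive_def cop_on_def by blast
next
  assume "cop_on {..<n} (entries A)"
  then show "copositive A"
    using A transpose_eq_iff_sym_on[OF A] unfolding copositive_def cop_on_def
    by (auto simp: scalar_prod_mult_mat_vec_qf[OF A])
qed

lemma pos_semidefinite_iff_psd_on:
  assumes A: "A \<in> carrier_mat n n"
  shows "pos_semidefinite A \<longleftrightarrow> psd_on {..<n} (entries A)"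
proof
  assume psd: "pos_semidefinite A"
  have "0 \<le> qf {..<n} (entries A) f" for f
  proof -
    have "0 \<le> vec n f \<bullet> (A *\<^sub>v vec n f)" using psd A unfolding pos_semidefinite_def by auto
    also have "\<dots> = qf {..<n} (entries A) (\<lambda>i. vec n f $ i)"
      by (rule scalar_prod_mult_mat_vec_qf[OF A]) simp
    also have "\<dots> = qf {..<n} (entries A) f" by (rule qf_cong) auto
    finally show ?thesis .
  qed
  then show "psd_on {..<n} (entries A)"
    using psd transpose_eq_iff_sym_on[OF A] unfolding pos_semidefinite_def psd_on_def by blast
next
  assume "psd_on {..<n} (entries A)"
  then show "pos_semidefinite A"
    using A transpose_eq_iff_sym_on[OF A] unfolding pos_semidefinite_def psd_on_def
    by (auto simp: scalar_prod_mult_mat_vec_qf[OF A])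
qed

lemma SPN_iff_spn_on:
  assumes A: "A \<in> carrier_mat n n" and sym: "transpose_mat A = A"
  shows "SPN A \<longleftrightarrow> spn_on {..<n} (entries A)"
proof
  assume "SPN A"
  then obtain P N where P: "P \<in> carrier_mat n n" "pos_semidefinite P"
    and N: "N \<in> carrier_mat n n" "sym_nonneg N" and eq: "A = P + N"
    using A unfolding SPN_def by auto
  have "P $$ (i, j) \<le> A $$ (i, j)" if "i < n" "j < n" for i j
    using that N P unfolding eq sym_nonneg_def by auto
  then show "spn_on {..<n} (entries A)"
    using P pos_semidefinite_iff_psd_on[OF P(1)] unfolding spn_on_def by (intro exI[of _ "entries P"]) auto
next
  assume "spn_on {..<n} (entries A)"
  then obtain Q where Q: "psd_on {..<n} Q" "\<And>i j. i < n \<Longrightarrow> j < n \<Longrightarrow> Q i j \<le> A $$ (i, j)"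
    unfolding spn_on_def by blast
  define P where "P = mat n n (\<lambda>(i, j). Q i j)"
  define N where "N = mat n n (\<lambda>(i, j). A $$ (i, j) - Q i j)"
  have car: "P \<in> carrier_mat n n" "N \<in> carrier_mat n n" unfolding P_def N_def by auto
  have symQ: "sym_on {..<n} Q" using Q(1) unfolding psd_on_def by blast
  have "qf {..<n} (entries P) x = qf {..<n} Q x" for x by (rule qf_cong) (auto simp: P_def)
  then have "psd_on {..<n} (entries P)"
    using Q(1) unfolding psd_on_def sym_on_def by (auto simp: P_def)
  then have "pos_semidefinite P" using pos_semidefinite_iff_psd_on[OF car(1)] by blast
  moreover have "sym_on {..<n} (entries A)" using sym transpose_eq_iff_sym_on[OF A] by blast
  then have "sym_on {..<n} (entries N)" using symQ unfolding sym_on_def N_def by auto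
  then have "transpose_mat N = N" using transpose_eq_iff_sym_on[OF car(2)] by blast
  then have "sym_nonneg N" using Q(2) car(2) unfolding sym_nonneg_def by (auto simp: N_def)
  moreover have "A = P + N" using A by (intro eq_matI) (auto simp: P_def N_def)
  ultimately show "SPN A" using car A unfolding SPN_def by auto
qed

section \<open>Graph isomorphisms and copies of the fan\<close>

text \<open>The ends of an arc are its projections, so the vertex map determines the arc map as
  \<open>map_prod f f\<close>. The well-formedness conjunct is what an isomorphism demands of its
  source.\<close>

lemma digraph_iso_with_proj_iff:
  "digraph_iso (with_proj G) (with_proj K) \<longleftrightarrow> wf_digraph (with_proj G) \<and>
    (\<exists>f. inj_on f (pverts G) \<and> pverts K = f ` pverts G \<and> parcs K = map_prod f f ` parcs G)"
proof
  assume "digraph_iso (with_proj G) (with_proj K)"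
  then obtain h where h: "pre_digraph.digraph_isomorphism (with_proj G) h"
    and K: "with_proj K = app_iso h (with_proj G)"
    unfolding digraph_iso_def by blast
  have ht: "iso_tail h = fst" "iso_head h = snd"
    using arg_cong[OF K, of tail] arg_cong[OF K, of head] by simp_all
  have "iso_arcs h a = map_prod (iso_verts h) (iso_verts h) a" if "a \<in> parcs G" for a
    using h that unfolding pre_digraph.digraph_isomorphism_def
    by (cases a; cases "iso_arcs h a") (auto simp: ht dest!: bspec[where x = a])
  then have "iso_arcs h ` parcs G = map_prod (iso_verts h) (iso_verts h) ` parcs G"
    by (rule image_cong[OF refl])
  then show "wf_digraph (with_proj G) \<and>
    (\<exists>f. inj_on f (pverts G) \<and> pverts K = f ` pverts G \<and> parcs K = map_prod f f ` parcs G)"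
    using h arg_cong[OF K, of verts] arg_cong[OF K, of arcs] unfolding pre_digraph.digraph_isomorphism_def
    by (intro conjI exI[of _ "iso_verts h"]) auto
next
  assume "wf_digraph (with_proj G) \<and>
    (\<exists>f. inj_on f (pverts G) \<and> pverts K = f ` pverts G \<and> parcs K = map_prod f f ` parcs G)"
  then obtain f where wf: "wf_digraph (with_proj G)" and f: "inj_on f (pverts G)" "pverts K = f ` pverts G"
    "parcs K = map_prod f f ` parcs G" by blast
  let ?h = "\<lparr>iso_verts = f, iso_arcs = map_prod f f, iso_head = snd, iso_tail = fst\<rparr>"
  have "parcs G \<subseteq> pverts G \<times> pverts G"
    using wf_digraph.tail_in_verts[OF wf] wf_digraph.head_in_verts[OF wf] by auto
  then have "inj_on (map_prod f f) (parcs G)"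
    using map_prod_inj_on[OF f(1) f(1)] inj_on_subset by blast
  then have "pre_digraph.digraph_isomorphism (with_proj G) ?h"
    using wf f unfolding pre_digraph.digraph_isomorphism_def by auto
  moreover have "with_proj K = app_iso ?h (with_proj G)"
    using f unfolding app_iso_def with_proj_def by simp
  ultimately show "digraph_iso (with_proj G) (with_proj K)" unfolding digraph_iso_def by blast
qed

lemma pair_graph_imp_wf_digraph: "pair_graph G \<Longrightarrow> wf_digraph (with_proj G)"
  by (simp add: pair_graph_def pair_digraph_def pair_fin_digraph_def pair_wf_digraph_def wf_digraph_def)

text \<open>The isomorphism runs from the subgraph to the fan, whereas an embedding \<open>g\<close>
  runs the other way; both directions pass through \<open>the_inv_into\<close>.\<close>

lemma contains_F5_iff:
  assumes G: "pair_graph (G :: 'a pair_pre_digraph)"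
  shows "contains_subgraph G F5 \<longleftrightarrow>
    (\<exists>g. inj_on g {..<5} \<and> g ` {..<5} \<subseteq> pverts G \<and> map_prod g g ` parcs F5 \<subseteq> parcs G)"
proof
  assume "contains_subgraph G F5"
  then obtain H :: "'a pair_pre_digraph" where H: "subgraph (with_proj H) (with_proj G)"
    and iso: "digraph_iso (with_proj H) (with_proj F5)"
    unfolding contains_subgraph_def by blast
  obtain f where wf: "wf_digraph (with_proj H)" and f: "inj_on f (pverts H)" "{..<5} = f ` pverts H"
    "parcs F5 = map_prod f f ` parcs H"
    using iso unfolding digraph_iso_with_proj_iff F5_simps(1) by blast
  define g where "g = the_inv_into (pverts H) f"
  have arcs: "fst e \<in> pverts H" "snd e \<in> pverts H" if "e \<in> parcs H" for e
    using wf_digraph.tail_in_verts[OF wf, of e] wf_digraph.head_in_verts[OF wf, of e] that by auto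
  have "g ` {..<5} = pverts H" unfolding g_def f(2) using f(1) by (rule the_inv_into_onto)
  moreover have "inj_on g {..<5}" unfolding g_def f(2) using f(1) by (rule inj_on_the_inv_into)
  moreover have "map_prod g g ` parcs F5 = parcs H"
  proof -
    have "map_prod g g (map_prod f f e) = e" if "e \<in> parcs H" for e
      using arcs[OF that] the_inv_into_f_f[OF f(1)] unfolding g_def by (cases e) auto
    then show ?thesis unfolding f(3) image_image by simp
  qed
  moreover have "pverts H \<subseteq> pverts G" "parcs H \<subseteq> parcs G" using H unfolding subgraph_def by auto
  ultimately show "\<exists>g. inj_on g {..<5} \<and> g ` {..<5} \<subseteq> pverts G \<and> map_prod g g ` parcs F5 \<subseteq> parcs G"
    by (intro exI[of _ g]) auto
next
  assume "\<exists>g. inj_on g {..<5} \<and> g ` {..<5} \<subseteq> pverts G \<and> map_prod g g ` parcs F5 \<subseteq> parcs G"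
  then obtain g where g: "inj_on g {..<5}" "g ` {..<5} \<subseteq> pverts G" "map_prod g g ` parcs F5 \<subseteq> parcs G"
    by blast
  define H where "H = \<lparr>pverts = g ` {..<5}, parcs = map_prod g g ` parcs F5\<rparr>"
  define f where "f = the_inv_into {..<5} g"
  have fg: "f (g i) = i" if "i < 5" for i unfolding f_def using g(1) that by (simp add: the_inv_into_f_f)
  have F5: "fst e < 5" "snd e < 5" if "e \<in> parcs F5" for e using that unfolding F5_simps by auto
  have wf: "wf_digraph (with_proj H)"
    by unfold_locales (use F5 in \<open>auto simp: H_def\<close>)
  have "subgraph (with_proj H) (with_proj G)"
    using g wf pair_graph_imp_wf_digraph[OF G] unfolding subgraph_def by (auto simp: H_def compatible_def)
  moreover have "digraph_iso (with_proj H) (with_proj F5)"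
    unfolding digraph_iso_with_proj_iff
  proof (intro conjI exI)
    show "inj_on f (pverts H)" unfolding f_def H_def using inj_on_the_inv_into[OF g(1)] by simp
    have "f ` g ` {..<5} = {..<5}" unfolding image_image using fg by simp
    then show "pverts F5 = f ` pverts H" unfolding H_def F5_simps by simp
    have "map_prod f f (map_prod g g e) = e" if "e \<in> parcs F5" for e
      using fg F5[OF that] by (cases e) auto
    then show "parcs F5 = map_prod f f ` parcs H" unfolding H_def by (simp add: image_image)
  qed (rule wf)
  ultimately show "contains_subgraph G F5" unfolding contains_subgraph_def by blast
qed

lemma fan_imp_not_SPN_graph:
  assumes G: "pair_graph G" and card: "card (pverts G) = 5" and fan: "contains_subgraph G F5"
  shows "\<not> SPN_graph G"
proof -
  obtain g where g: "inj_on g {..<5}" "g ` {..<5} \<subseteq> pverts G" "map_prod g g ` parcs F5 \<subseteq> parcs G"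
    using fan unfolding contains_F5_iff[OF G] by blast
  have fin: "finite (pverts G)" using card by (metis card.infinite zero_neq_numeral)
  have onto: "g ` {..<5} = pverts G"
    by (rule card_subset_eq[OF fin g(2)]) (use card card_image[OF g(1)] in simp)
  interpret G: pair_graph G by (rule G)
  have symG: "(b, a) \<in> parcs G" if "(a, b) \<in> parcs G" for a b
    using G.pair_sym_arcs that by (auto simp: symmetric_def dest: symD)
  \<comment> \<open>The graph of the matrix has to be exactly \<open>G\<close>, so edges of
    \<open>G\<close> outside the fan receive a nonzero value that the extension lemmas allow. As the
    fan is spanning, \<open>g\<close> labels all vertices.\<close>
  define M where "M = (\<lambda>i j. if fan_form i j \<noteq> 0 then fan_form i j
     else if (g i, g j) \<in> parcs G then 1 / 2 else 0)"
  have M: "M i j = M j i" "fan_form i j \<noteq> 0 \<Longrightarrow> M i j = fan_form i j"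
    "fan_form i j = 0 \<Longrightarrow> 0 \<le> M i j \<and> M i j \<le> 1 / 2" if "i < 5" "j < 5" for i j
    using fan_form_sym[of i j] symG[of "g i" "g j"] symG[of "g j" "g i"] unfolding M_def by auto
  define A where "A = mat 5 5 (\<lambda>(i, j). M i j)"
  have A: "A \<in> carrier_mat 5 5" unfolding A_def by simp
  have qf: "qf {..<5} (entries A) x = qf {..<5} M x" for x by (rule qf_cong) (auto simp: A_def)
  have sym: "sym_on {..<5} (entries A)" using M(1) unfolding sym_on_def A_def by auto
  have cop: "cop_on {..<5} (entries A)"
    using fan_extension_cop[of M] M sym unfolding cop_on_def qf by blast
  then have "copositive A" using copositive_iff_cop_on[OF A] by blast
  moreover have "\<not> SPN A"
  proof
    assume "SPN A"
    moreover have "transpose_mat A = A" using sym transpose_eq_iff_sym_on[OF A] by blast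
    ultimately have "spn_on {..<5} (entries A)" using SPN_iff_spn_on[OF A] by blast
    then have "spn_on {..<5} M" by (rule spn_on_mono) (simp add: A_def)
    moreover have "\<not> spn_on {..<5} M" by (rule fan_extension_not_spn) (use M in auto)
    ultimately show False by blast
  qed
  moreover have "digraph_iso (with_proj (mat_graph A)) (with_proj G)"
    unfolding digraph_iso_with_proj_iff
  proof (intro conjI exI)
    have verts: "pverts (mat_graph A) = {..<5}" by (simp add: mat_graph_def A_def)
    show "wf_digraph (with_proj (mat_graph A))"
      by unfold_locales (auto simp: mat_graph_def)
    show "inj_on g (pverts (mat_graph A))" using g(1) verts by simp
    show "pverts G = g ` pverts (mat_graph A)" using onto verts by simp
    have edge: "M i j \<noteq> 0 \<longleftrightarrow> (g i, g j) \<in> parcs G" if "i < 5" "j < 5" "i \<noteq> j" for i j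
      using fan_form_nonzero_iff[OF that(3)] g(3) unfolding M_def by (auto simp: image_subset_iff)
    show "parcs G = map_prod g g ` parcs (mat_graph A)"
    proof
      show "map_prod g g ` parcs (mat_graph A) \<subseteq> parcs G"
        using edge by (auto simp: mat_graph_def A_def)
      show "parcs G \<subseteq> map_prod g g ` parcs (mat_graph A)"
      proof
        fix e assume e: "e \<in> parcs G"
        then have "fst e \<in> g ` {..<5}" "snd e \<in> g ` {..<5}"
          unfolding onto using G.arc_fst_in_verts G.arc_snd_in_verts by auto
        then obtain i j where ij: "i < 5" "j < 5" "e = (g i, g j)" by (cases e) auto
        then have "i \<noteq> j" using G.pair_no_loops[OF e] by auto
        then have "(i, j) \<in> parcs (mat_graph A)"
          using edge ij e by (auto simp: mat_graph_def A_def)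
        then show "e \<in> map_prod g g ` parcs (mat_graph A)" using ij by (auto intro: rev_image_eqI)
      qed
    qed
  qed
  ultimately show ?thesis unfolding SPN_graph_def by blast
qed

section \<open>Fan-free graphs through their complements\<close>

lemma obtain_two_more:
  assumes "card S = 5" "a \<in> S" "b \<in> S" "c \<in> S" "distinct [a, b, c]"
  obtains d e where "S = {a, b, c, d, e}" "distinct [a, b, c, d, e]"
proof -
  have "card (S - {a, b, c}) = card S - card {a, b, c}"
    using assms by (intro card_Diff_subset) auto
  then have "card (S - {a, b, c}) = 2" using assms by simp
  then obtain d e where de: "S - {a, b, c} = {d, e}" "d \<noteq> e" by (auto simp: card_2_iff)
  have "S = {a, b, c} \<union> (S - {a, b, c})" using assms by auto
  then have "S = {a, b, c, d, e}" unfolding de(1) by auto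
  moreover have "d \<notin> {a, b, c}" "e \<notin> {a, b, c}" using de(1) by auto
  ultimately show ?thesis using that[of d e] assms(5) de(2) by auto
qed

text \<open>A graph on five vertices contains the fan iff its complement lies in a path on four
  vertices. \<open>Z\<close> is adjacency in the complement; the fan has hub \<open>h\<close> and path \<open>q, s, p, r\<close>.\<close>

lemma fan_or_zero_pattern:
  assumes card: "card S = 5" and sym: "\<And>i j. Z i j \<Longrightarrow> Z j i"
    and star: "\<And>v w a b c. S = {v, w, a, b, c} \<Longrightarrow> distinct [v, w, a, b, c] \<Longrightarrow>
      Z v a \<Longrightarrow> Z v b \<Longrightarrow> Z v c \<Longrightarrow> False"
    and path_edge: "\<And>a b c d e. S = {a, b, c, d, e} \<Longrightarrow> distinct [a, b, c, d, e] \<Longrightarrow>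
      Z a b \<Longrightarrow> Z b c \<Longrightarrow> Z d e \<Longrightarrow> False"
    and triangle: "\<And>p q x y z. S = {p, q, x, y, z} \<Longrightarrow> distinct [p, q, x, y, z] \<Longrightarrow>
      Z x y \<Longrightarrow> Z x z \<Longrightarrow> Z y z \<Longrightarrow> False"
    and square: "\<And>r a b c d. S = {r, a, b, c, d} \<Longrightarrow> distinct [r, a, b, c, d] \<Longrightarrow>
      Z a c \<Longrightarrow> Z a d \<Longrightarrow> Z b c \<Longrightarrow> Z b d \<Longrightarrow> False"
  obtains p q r s h where "S = {p, q, r, s, h}" "distinct [p, q, r, s, h]"
    "\<not> Z p r" "\<not> Z p s" "\<not> Z q s" "\<not> Z h p" "\<not> Z h q" "\<not> Z h r" "\<not> Z h s"
proof (cases "\<exists>a b c. a \<in> S \<and> b \<in> S \<and> c \<in> S \<and> distinct [a, b, c] \<and> Z a b \<and> Z b c")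
  case True
  then obtain a b c where abc: "a \<in> S" "b \<in> S" "c \<in> S" "distinct [a, b, c]" and Z: "Z a b" "Z b c"
    by blast
  then obtain d e where S: "S = {a, b, c, d, e}" and dist: "distinct [a, b, c, d, e]"
    using obtain_two_more[OF card] by metis
  note Zs = Z sym[OF Z(1)] sym[OF Z(2)]
  have ac: "\<not> Z a c"
    using triangle[of d e a b c] S dist Zs by auto
  have bd: "\<not> Z b d" "\<not> Z b e"
    using star[of b e a c d] star[of b d a c e] S dist Zs by auto
  have de: "\<not> Z d e"
    using path_edge[of a b c d e] S dist Zs by auto
  have 1: "\<not> (Z a d \<and> Z a e)" "\<not> (Z c d \<and> Z c e)"
    using star[of a c b d e] star[of c a b d e] S dist Zs by auto
  have 2: "\<not> (Z a d \<and> Z c d)" "\<not> (Z a e \<and> Z c e)"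
    using square[of e a c b d] square[of d a c b e] S dist Zs by auto
  have 3: "\<not> (Z a d \<and> Z c e)" "\<not> (Z a e \<and> Z c d)"
    using path_edge[of d a b c e] path_edge[of e a b c d] sym[of a d] sym[of a e] S dist Zs by auto
  note sy = sym[of c a] sym[of d b] sym[of e b] sym[of e d] sym[of d c] sym[of e a] sym[of e c] sym[of d a]
  \<comment> \<open>All six pairs among the complement edges \<open>a d\<close>, \<open>a e\<close>,
    \<open>c d\<close>, \<open>c e\<close> are excluded, so at most one is present and extends the
    path \<open>a b c\<close> at an end. The untouched vertex is the hub; the complement of a path
    on four vertices is again such a path.\<close>
  consider "\<not> Z a e" "\<not> Z c d" "\<not> Z c e" | "\<not> Z a d" "\<not> Z c d" "\<not> Z c e"
    | "\<not> Z a d" "\<not> Z a e" "\<not> Z c e" | "\<not> Z a d" "\<not> Z a e" "\<not> Z c d"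
    using 1 2 3 by blast
  then show ?thesis
  proof cases
    case 1
    show ?thesis
      by (rule that[of d a b c e]) (use S dist 1 ac bd de sy in auto)
  next
    case 2
    show ?thesis
      by (rule that[of e a b c d]) (use S dist 2 ac bd de sy sym[of d e] in auto)
  next
    case 3
    show ?thesis
      by (rule that[of a b c d e]) (use S dist 3 ac bd de sy in auto)
  next
    case 4
    show ?thesis
      by (rule that[of a b c e d]) (use S dist 4 ac bd de sy sym[of d e] in auto)
  qed
next
  case no_path: False
  show ?thesis
  proof (cases "\<exists>a b. a \<in> S \<and> b \<in> S \<and> a \<noteq> b \<and> Z a b")
    case True
    then obtain a b where ab: "a \<in> S" "b \<in> S" "a \<noteq> b" "Z a b" by blast
    have "S - {a, b} \<noteq> {}"
    proof
      assume "S - {a, b} = {}"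
      then have "card S \<le> card {a, b}" by (intro card_mono) auto
      then show False using card ab by simp
    qed
    then obtain c where "c \<in> S" "c \<noteq> a" "c \<noteq> b" by blast
    then obtain d e where S: "S = {a, b, c, d, e}" and dist: "distinct [a, b, c, d, e]"
      using obtain_two_more[OF card ab(1,2), of c] ab(3) by auto
    have isolated: "\<not> Z a v" "\<not> Z v a" "\<not> Z b v" "\<not> Z v b" if "v \<in> {c, d, e}" for v
    proof -
      have v: "v \<in> S" "v \<noteq> a" "v \<noteq> b" using that S dist by auto
      have "\<not> (Z b a \<and> Z a v)" "\<not> (Z a b \<and> Z b v)" using no_path ab v by auto
      then show "\<not> Z a v" "\<not> Z b v" using ab(4) sym[OF ab(4)] by auto
      then show "\<not> Z v a" "\<not> Z v b" using sym by blast+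
    qed
    \<comment> \<open>The complement is now a matching: besides \<open>a b\<close> it has at most
      one edge, inside \<open>{c, d, e}\<close>. The two edges serve as the outer edges
      \<open>p q\<close> and \<open>r s\<close> of the complement path.\<close>
    have "\<not> (Z c d \<and> Z d e)" "\<not> (Z d c \<and> Z c e)" "\<not> (Z d e \<and> Z e c)"
      using no_path S dist by auto
    then consider "\<not> Z c d" "\<not> Z c e" | "\<not> Z c d" "\<not> Z d e" | "\<not> Z c e" "\<not> Z d e"
      using sym by blast
    then show ?thesis
    proof cases
      case 1
      show ?thesis
        by (rule that[of a b d e c]) (use S dist 1 isolated in auto)
    next
      case 2
      show ?thesis
        by (rule that[of a b c e d]) (use S dist 2 isolated sym[of d c] in auto)
    next
      case 3
      show ?thesis
        by (rule that[of a b c d e]) (use S dist 3 isolated sym[of e c] sym[of e d] in auto)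
    qed
  next
    case False
    obtain p where p: "p \<in> S" using card by fastforce
    have "S - {p} \<noteq> {}"
    proof
      assume "S - {p} = {}"
      then have "card S \<le> card {p}" by (intro card_mono) auto
      then show False using card by simp
    qed
    then obtain q where q: "q \<in> S" "q \<noteq> p" by blast
    have "S - {p, q} \<noteq> {}"
    proof
      assume "S - {p, q} = {}"
      then have "card S \<le> card {p, q}" by (intro card_mono) auto
      then show False using card q by simp
    qed
    then obtain r where "r \<in> S" "r \<noteq> p" "r \<noteq> q" by blast
    then obtain s h where S: "S = {p, q, r, s, h}" and dist: "distinct [p, q, r, s, h]"
      using obtain_two_more[OF card p q(1), of r] q(2) by auto
    show ?thesis
      by (rule that[OF S dist]) (use False S dist in auto)
  qed
qed

text \<open>The four lemmas on zero patterns ask only for zeros and never for nonzero entries, so it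
  suffices that the complement contains one of the four configurations.\<close>

lemma no_fan_imp_scop_spn:
  assumes card: "card S = 5" and A: "scop_on S A"
    and no_fan: "\<And>p q r s h. S = {p, q, r, s, h} \<Longrightarrow> distinct [p, q, r, s, h] \<Longrightarrow> A p r \<noteq> 0 \<Longrightarrow>
      A p s \<noteq> 0 \<Longrightarrow> A q s \<noteq> 0 \<Longrightarrow> A h p \<noteq> 0 \<Longrightarrow> A h q \<noteq> 0 \<Longrightarrow> A h r \<noteq> 0 \<Longrightarrow> A h s \<noteq> 0 \<Longrightarrow> False"
  shows "spn_on S A"
proof (rule ccontr)
  assume no: "\<not> spn_on S A"
  \<comment> \<open>Membership in \<open>S\<close> is built in because \<open>A\<close> is symmetric
    only there, while \<open>Z\<close> must be symmetric everywhere.\<close>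
  define Z where "Z i j \<longleftrightarrow> i \<in> S \<and> j \<in> S \<and> A i j = 0" for i j
  have ZD: "A i j = 0" if "Z i j" for i j using that unfolding Z_def by blast
  show False
  proof (rule fan_or_zero_pattern[OF card, of Z])
    show "Z j i" if "Z i j" for i j
      using that A unfolding Z_def scop_on_def sym_on_def by auto
    show False if "S = {v, w, a, b, c}" "distinct [v, w, a, b, c]" "Z v a" "Z v b" "Z v c" for v w a b c
      using pendant_spn[OF that(1,2) A] that(3-5)[THEN ZD] no by blast
    show False if "S = {a, b, c, d, e}" "distinct [a, b, c, d, e]" "Z a b" "Z b c" "Z d e" for a b c d e
      using subdivided_K4_spn[OF that(1,2) A] that(3-5)[THEN ZD] no by blast
    show False if "S = {p, q, x, y, z}" "distinct [p, q, x, y, z]" "Z x y" "Z x z" "Z y z" for p q x y z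
      using T5_spn[OF that(1,2) A] that(3-5)[THEN ZD] no by blast
    show False if "S = {r, a, b, c, d}" "distinct [r, a, b, c, d]" "Z a c" "Z a d" "Z b c" "Z b d" for r a b c d
      using bowtie_spn[OF that(1,2) A] that(3-6)[THEN ZD] no by blast
    fix p q r s h
    assume *: "S = {p, q, r, s, h}" "distinct [p, q, r, s, h]"
      "\<not> Z p r" "\<not> Z p s" "\<not> Z q s" "\<not> Z h p" "\<not> Z h q" "\<not> Z h r" "\<not> Z h s"
    have "A i j \<noteq> 0" if "\<not> Z i j" "i \<in> S" "j \<in> S" for i j using that unfolding Z_def by blast
    then show False using no_fan[OF *(1,2)] *(1,3-9) by blast
  qed
qed

lemma no_fan_imp_cop_spn:
  assumes card: "card S = 5" and A: "cop_on S A"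
    and no_fan: "\<And>p q r s h. S = {p, q, r, s, h} \<Longrightarrow> distinct [p, q, r, s, h] \<Longrightarrow> A p r \<noteq> 0 \<Longrightarrow>
      A p s \<noteq> 0 \<Longrightarrow> A q s \<noteq> 0 \<Longrightarrow> A h p \<noteq> 0 \<Longrightarrow> A h q \<noteq> 0 \<Longrightarrow> A h r \<noteq> 0 \<Longrightarrow> A h s \<noteq> 0 \<Longrightarrow> False"
  shows "spn_on S A"
proof -
  have fin: "finite S" using card by (metis card.infinite zero_neq_numeral)
  show ?thesis
  proof (rule spn_on_closed[OF fin])
    fix e :: real assume e: "e > 0"
    show "spn_on S (add_diag e A)"
    proof (rule no_fan_imp_scop_spn[OF card cop_add_diag_scop[OF A fin e]])
      fix p q r s h
      assume *: "S = {p, q, r, s, h}" "distinct [p, q, r, s, h]"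
        "add_diag e A p r \<noteq> 0" "add_diag e A p s \<noteq> 0" "add_diag e A q s \<noteq> 0"
        "add_diag e A h p \<noteq> 0" "add_diag e A h q \<noteq> 0" "add_diag e A h r \<noteq> 0" "add_diag e A h s \<noteq> 0"
      have "add_diag e A i j = A i j" if "i \<noteq> j" for i j using that by (simp add: add_diag_def)
      then show False using no_fan[OF *(1,2)] *(2-9) by auto
    qed
  qed
qed

lemma no_fan_imp_SPN_graph:
  assumes G: "pair_graph G" and card: "card (pverts G) = 5" and fan: "\<not> contains_subgraph G F5"
  shows "SPN_graph G"
  unfolding SPN_graph_def
proof (intro allI impI)
  fix A assume "copositive A \<and> digraph_iso (with_proj (mat_graph A)) (with_proj G)"
  then have cop: "copositive A" and iso: "digraph_iso (with_proj (mat_graph A)) (with_proj G)" by auto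
  have t: "transpose_mat A = A" using cop unfolding copositive_def by blast
  obtain f where f: "inj_on f (pverts (mat_graph A))" "pverts G = f ` pverts (mat_graph A)"
    "parcs G = map_prod f f ` parcs (mat_graph A)"
    using iso unfolding digraph_iso_with_proj_iff by blast
  have verts: "pverts (mat_graph A) = {..<dim_row A}" by (simp add: mat_graph_def)
  have n: "dim_row A = 5" using card card_image[OF f(1)] unfolding f(2) verts by simp
  have A: "A \<in> carrier_mat 5 5" using transpose_eq_imp_square[OF t] n by simp
  have copA: "cop_on {..<5} (entries A)" using cop copositive_iff_cop_on[OF A] by blast
  have sym: "A $$ (i, j) = A $$ (j, i)" if "i < 5" "j < 5" for i j
    using copA that unfolding cop_on_def sym_on_def by auto
  have edge: "(f i, f j) \<in> parcs G" "(f j, f i) \<in> parcs G" if "i < 5" "j < 5" "i \<noteq> j" "A $$ (i, j) \<noteq> 0" for i j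
  proof -
    have "(i, j) \<in> parcs (mat_graph A)" "(j, i) \<in> parcs (mat_graph A)"
      using that sym[OF that(1,2)] n by (auto simp: mat_graph_def)
    then show "(f i, f j) \<in> parcs G" "(f j, f i) \<in> parcs G"
      unfolding f(3) by (auto intro: map_prod_imageI)
  qed
  have "spn_on {..<5} (entries A)"
  proof (rule no_fan_imp_cop_spn[OF _ copA])
    fix p q r s h
    assume S: "{..<5} = {p, q, r, s, h}" and dist: "distinct [p, q, r, s, h]"
      and nz: "A $$ (p, r) \<noteq> 0" "A $$ (p, s) \<noteq> 0" "A $$ (q, s) \<noteq> 0"
        "A $$ (h, p) \<noteq> 0" "A $$ (h, q) \<noteq> 0" "A $$ (h, r) \<noteq> 0" "A $$ (h, s) \<noteq> 0"
    have lt: "p < 5" "q < 5" "r < 5" "s < 5" "h < 5" using S by auto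
    \<comment> \<open>The path \<open>q\<close>, \<open>s\<close>, \<open>p\<close>,
      \<open>r\<close> with hub \<open>h\<close> is matched with the path 0, 1, 2, 3 and hub 4 of
      \<open>F5\<close>.\<close>
    define l where "l i = (if i = 0 then q else if i = 1 then s else if i = 2 then p else if i = 3 then r else h)"
      for i :: nat
    have l: "l 0 = q" "l 1 = s" "l (Suc 0) = s" "l 2 = p" "l 3 = r" "l 4 = h" by (auto simp: l_def)
    have "l ` {..<5} = {p, q, r, s, h}" unfolding lessThan_5 by (auto simp: l)
    then have lS: "l ` {..<5} = {..<5}" unfolding S .
    have "inj_on l {..<5}" by (rule eq_card_imp_inj_on) (simp_all add: lS)
    then have "inj_on (f \<circ> l) {..<5}" using f(1) lS verts n by (simp add: comp_inj_on)
    moreover have "(f \<circ> l) ` {..<5} \<subseteq> pverts G" using f(2) verts n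
      unfolding image_comp[symmetric] lS by simp
    moreover have "map_prod (f \<circ> l) (f \<circ> l) ` parcs F5 \<subseteq> parcs G"
      unfolding F5_simps using dist edge[OF lt(1,3) _ nz(1)] edge[OF lt(1,4) _ nz(2)] edge[OF lt(2,4) _ nz(3)]
        edge[OF lt(5,1) _ nz(4)] edge[OF lt(5,2) _ nz(5)] edge[OF lt(5,3) _ nz(6)] edge[OF lt(5,4) _ nz(7)]
      by (auto simp: l)
    ultimately show False using fan unfolding contains_F5_iff[OF G] by blast
  qed simp
  then show "SPN A" using SPN_iff_spn_on[OF A t] by blast
qed

theorem theorem7p3:
  fixes G :: "'a pair_pre_digraph"
  assumes "pair_graph G"
    and "card (pverts G) = 5"
  shows "SPN_graph G \<longleftrightarrow> \<not> contains_subgraph G F5"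
  using fan_imp_not_SPN_graph[OF assms] no_fan_imp_SPN_graph[OF assms] by blast

end
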